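(* Let $n\ge3$ and let $F=u\,\phi(r,s)$ be a spherically symmetric Finsler metric in dimension $n$. Then $F$ satisfies the $\sigma T$-condition if and only if either $F$ satisfies the $T$-condition, or there exist smooth functions $A(r)>0$, $c_1(r)$, $c_2(r)$ of $r$ such that $$\phi(r,s)=A(r)\,\exp\left(\int\frac{c_1(r)\,s+c_2(r)\sqrt{r^2-s^2}}{1+c_1(r)\,s^2+c_2(r)\,s\sqrt{r^2-s^2}}\,ds\right),$$ where $\int\cdots ds$ denotes a primitive in $s$ for fixed $r$.
   Context: Setting: $\mathcal D\subset\{(r,s): r>0,\ |s|<r\}$ is a nonempty connected open set such that for each $r$ the set $\{s:(r,s)\in\mathcal D\}$ is an interval (possibly empty), and $\phi:\mathcal D\to(0,\infty)$ is smooth. $F(x,y)=u\,\phi(r,s)$ with $r=|x|$, $u=|y|$, $s=\langle x,y\rangle/|y|$ (Euclidean inner product and norm on $\mathbb{R}^n$), defined for those $(x,y)$, $y\neq0$, with $(r,s)\in\mathcal D$. $F$ is a Finsler metric in the sense that $\phi-s\phi_s\neq0$ and $\phi-s\phi_s+(r^2-s^2)\phi_{ss}\neq0$ on $\mathcal D$ (subscripts are partial derivatives), so $g_{ij}=\frac12\partial^2F^2/\partial y^i\partial y^j$ is nondegenerate. T-tensor: with $\ell_i=\partial F/\partial y^i$, $C_{ijk}=\frac12\partial g_{ij}/\partial y^k$, $C^r_{ij}=g^{rk}C_{kij}$, $$T_{hijk}=F\Big(\frac{\partial C_{hij}}{\partial y^k}-C^r_{hk}C_{rij}-C^r_{ik}C_{hrj}-C^r_{jk}C_{hir}\Big)+C_{hij}\ell_k+C_{hik}\ell_j+C_{hjk}\ell_i+C_{ijk}\ell_h,$$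 and $T^h_{ijk}=g^{hr}T_{rijk}$. $T$-condition: $T_{hijk}=0$ identically. $\sigma T$-condition: there is a smooth function $\sigma=\sigma(x)$ on the base domain $\{x: (|x|,s)\in\mathcal D\text{ for some }s\}$, with $d\sigma$ nowhere zero, such that $\sigma_hT^h_{ijk}=0$ identically, where $\sigma_h=\partial\sigma/\partial x^h$. *)

theory Defs
  imports "HOL-Analysis.Analysis"
begin

text \<open>
  Smoothness on a set \<open>S\<close>, intended for open \<open>S\<close> only: \<open>f\<close> has continuous iterated
  directional derivatives of all orders at the points of \<open>S\<close>.
\<close>

primrec Ck_on :: "nat \<Rightarrow> 'a::euclidean_space set \<Rightarrow> ('a \<Rightarrow> real) \<Rightarrow> bool" where
  "Ck_on 0 S f \<longleftrightarrow> continuous_on S f"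
| "Ck_on (Suc k) S f \<longleftrightarrow>
     (\<forall>x\<in>S. f differentiable (at x)) \<and>
     (\<forall>v. Ck_on k S (\<lambda>x. frechet_derivative f (at x) v))"

definition smooth_on :: "'a::euclidean_space set \<Rightarrow> ('a \<Rightarrow> real) \<Rightarrow> bool" where
  "smooth_on S f \<longleftrightarrow> (\<forall>k. Ck_on k S f)"

definition partial :: "'n \<Rightarrow> (real^'n::finite \<Rightarrow> real) \<Rightarrow> real^'n \<Rightarrow> real" where
  "partial i f y = frechet_derivative f (at y) (axis i 1)"

text \<open>
  Tensors of a function \<open>F x y\<close> on (part of) the tangent bundle of \<open>\<real>\<^sup>n\<close>; all derivatives are
  taken in \<open>y\<close> with \<open>x\<close> fixed. As these depend only on the germ of \<open>F x\<close> at \<open>y\<close>, the values of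
  the total function \<open>F\<close> outside an open domain of definition are irrelevant on that domain.
\<close>

definition fund_tensor :: "(real^'n::finite \<Rightarrow> real^'n \<Rightarrow> real) \<Rightarrow> real^'n \<Rightarrow> real^'n \<Rightarrow> real^'n^'n" where
  "fund_tensor F x y = (\<chi> i j. 1/2 * partial i (partial j (\<lambda>z. (F x z)\<^sup>2)) y)"

definition inv_fund_tensor :: "(real^'n::finite \<Rightarrow> real^'n \<Rightarrow> real) \<Rightarrow> real^'n \<Rightarrow> real^'n \<Rightarrow> real^'n^'n" where
  "inv_fund_tensor F x y = matrix_inv (fund_tensor F x y)"

definition ell :: "(real^'n::finite \<Rightarrow> real^'n \<Rightarrow> real) \<Rightarrow> real^'n \<Rightarrow> real^'n \<Rightarrow> 'n \<Rightarrow> real" where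
  "ell F x y i = partial i (F x) y"

definition cartan :: "(real^'n::finite \<Rightarrow> real^'n \<Rightarrow> real) \<Rightarrow> real^'n \<Rightarrow> real^'n \<Rightarrow> 'n \<Rightarrow> 'n \<Rightarrow> 'n \<Rightarrow> real" where
  "cartan F x y i j k = 1/2 * partial k (\<lambda>z. fund_tensor F x z $ i $ j) y"

text \<open>\<open>cartan_up F x y r i j\<close> is \<open>C\<^sup>r\<^sub>i\<^sub>j\<close>: the first index is the raised one.\<close>

definition cartan_up :: "(real^'n::finite \<Rightarrow> real^'n \<Rightarrow> real) \<Rightarrow> real^'n \<Rightarrow> real^'n \<Rightarrow> 'n \<Rightarrow> 'n \<Rightarrow> 'n \<Rightarrow> real" where
  "cartan_up F x y r i j = (\<Sum>k\<in>UNIV. inv_fund_tensor F x y $ r $ k * cartan F x y k i j)"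

definition T_tensor ::
  "(real^'n::finite \<Rightarrow> real^'n \<Rightarrow> real) \<Rightarrow> real^'n \<Rightarrow> real^'n \<Rightarrow> 'n \<Rightarrow> 'n \<Rightarrow> 'n \<Rightarrow> 'n \<Rightarrow> real" where
  "T_tensor F x y h i j k =
     F x y * (partial k (\<lambda>z. cartan F x z h i j) y
              - (\<Sum>r\<in>UNIV. cartan_up F x y r h k * cartan F x y r i j)
              - (\<Sum>r\<in>UNIV. cartan_up F x y r i k * cartan F x y h r j)
              - (\<Sum>r\<in>UNIV. cartan_up F x y r j k * cartan F x y h i r))
     + cartan F x y h i j * ell F x y k + cartan F x y h i k * ell F x y j
     + cartan F x y h j k * ell F x y i + cartan F x y i j k * ell F x y h"

text \<open>\<open>T_tensor_up F x y h i j k\<close> is \<open>T\<^sup>h\<^sub>i\<^sub>j\<^sub>k\<close>: the first index is the raised one.\<close>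

definition T_tensor_up ::
  "(real^'n::finite \<Rightarrow> real^'n \<Rightarrow> real) \<Rightarrow> real^'n \<Rightarrow> real^'n \<Rightarrow> 'n \<Rightarrow> 'n \<Rightarrow> 'n \<Rightarrow> 'n \<Rightarrow> real" where
  "T_tensor_up F x y h i j k = (\<Sum>r\<in>UNIV. inv_fund_tensor F x y $ h $ r * T_tensor F x y r i j k)"

text \<open>
  In the next two definitions \<open>M\<close> is the set of pairs \<open>(x, y)\<close> on which \<open>F\<close> is considered, and
  \<open>B\<close> the base domain on which \<open>\<sigma>\<close> lives.
\<close>

definition T_condition ::
  "((real^'n::finite) \<times> (real^'n)) set \<Rightarrow> (real^'n \<Rightarrow> real^'n \<Rightarrow> real) \<Rightarrow> bool" where
  "T_condition M F \<longleftrightarrow> (\<forall>(x, y)\<in>M. \<forall>h i j k. T_tensor F x y h i j k = 0)"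

definition sigmaT_condition ::
  "(real^'n::finite) set \<Rightarrow> ((real^'n) \<times> (real^'n)) set \<Rightarrow> (real^'n \<Rightarrow> real^'n \<Rightarrow> real) \<Rightarrow> bool" where
  "sigmaT_condition B M F \<longleftrightarrow>
     (\<exists>\<sigma>. smooth_on B \<sigma> \<and>
          (\<forall>x\<in>B. \<exists>h. partial h \<sigma> x \<noteq> 0) \<and>
          (\<forall>(x, y)\<in>M. \<forall>i j k. (\<Sum>h\<in>UNIV. partial h \<sigma> x * T_tensor_up F x y h i j k) = 0))"

definition sph_metric :: "(real \<Rightarrow> real \<Rightarrow> real) \<Rightarrow> real^'n::finite \<Rightarrow> real^'n \<Rightarrow> real" where
  "sph_metric \<phi> x y = norm y * \<phi> (norm x) (x \<bullet> y / norm y)"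

definition sph_domain :: "(real \<times> real) set \<Rightarrow> ((real^'n::finite) \<times> (real^'n)) set" where
  "sph_domain D = {(x, y). y \<noteq> 0 \<and> (norm x, x \<bullet> y / norm y) \<in> D}"

definition base_domain :: "(real \<times> real) set \<Rightarrow> (real^'n::finite) set" where
  "base_domain D = {x. \<exists>s. (norm x, s) \<in> D}"

text \<open>
  Admissible data \<open>(D, \<phi>)\<close>: the last condition makes the fundamental tensor of
  \<open>sph_metric \<phi>\<close> nondegenerate on \<open>sph_domain D\<close> (positive definiteness is not required).
  Partial derivatives in the second argument are one-variable derivatives of \<open>\<phi> r\<close>.
\<close>

definition sph_finsler :: "(real \<times> real) set \<Rightarrow> (real \<Rightarrow> real \<Rightarrow> real) \<Rightarrow> bool" where
  "sph_finsler D \<phi> \<longleftrightarrow>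
     D \<noteq> {} \<and> open D \<and> connected D \<and> D \<subseteq> {(r, s). r > 0 \<and> \<bar>s\<bar> < r} \<and>
     (\<forall>r. is_interval {s. (r, s) \<in> D}) \<and>
     smooth_on D (\<lambda>(r, s). \<phi> r s) \<and>
     (\<forall>(r, s)\<in>D. \<phi> r s > 0) \<and>
     (\<forall>(r, s)\<in>D.
        \<phi> r s - s * deriv (\<phi> r) s \<noteq> 0 \<and>
        \<phi> r s - s * deriv (\<phi> r) s + (r\<^sup>2 - s\<^sup>2) * deriv (deriv (\<phi> r)) s \<noteq> 0)"

end

(*
  Fix x and split the y-space at y into the line of y, the direction omega of grad s, and the
  orthogonal complement of x and y, with Euclidean projection p onto the last. By rotational
  symmetry the T-tensor has the form
    phi / (2 |y|) * (A4 omega^4 + B4 Sym(omega omega p) + C4 Sym(p p))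
  with coefficients depending on (r, s) only. Contracting the sigmaT-condition with vectors
  orthogonal to x and y (they exist as n >= 3) forces B4 = 0. In terms of
  psi = phi_s / (phi - s phi_s) one has B4 = - c E1 E2 with c nowhere zero: E2 = 0 is a linear
  second order equation for psi with solutions c1 s + c2 sqrt (r^2 - s^2), which is the explicit
  family and makes A4 vanish, so that sigma = |x|^2 works; E1 = 0 makes A4 and C4 vanish, which is
  the T-condition. Nondegeneracy prevents E1 = E1' = E2 = 0 at a point, so {E1 = E1' = 0} and
  {E2 = 0} are disjoint closed sets covering the connected set D, and one of them is all of D.
*)

theory Submission
  imports Defs
begin

section \<open>Smooth functions\<close>

text \<open>The exponential formula is the logarithmic derivative read backwards: phi_s / phi = psi
  / (1 + s psi), and this quotient determines psi again, so prescribing psi on a slice prescribes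
  phi up to a factor depending on r. In terms of psi, E2 = 0 reads (r^2 - s^2) psi_ss - s psi_s +
  psi = 0. The function sigma need not be radial: its gradient has a part along x and a part
  orthogonal to x, and B4 has to be detected through either of them. Since B4 depends on (r, s)
  only, one pair (x, y) for each (r, s) is enough, and y can be chosen after the gradient, in a
  plane through x orthogonal to the transverse part. The third dimension gives room for this. The
  two branches differ in C4, which contains the factor E1 but not E2. On the second branch T itself
  may survive; its contraction with x vanishes because x lies in the span of y and omega, where p is
  zero. Since phi is only smooth, E1 E2 = 0 does not by itself make one factor vanish identically,
  not even on a single slice; the zero set of E1 has to be cut down by its derivative before
  connectedness applies.\<close>

lemma Ck_on_cong:
  assumes "open S" "\<And>x. x \<in> S \<Longrightarrow> f x = g x" "Ck_on k S f"
  shows "Ck_on k S g"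
  using assms(2,3)
proof (induction k arbitrary: f g)
  case 0
  then show ?case by (simp cong: continuous_on_cong)
next
  case (Suc k)
  have d: "(g has_derivative frechet_derivative f (at x)) (at x)" if "x \<in> S" for x
    using Suc.prems that assms(1) has_derivative_transform_within_open[of f _ x UNIV S g]
    by (auto simp: frechet_derivative_works)
  then have eq: "frechet_derivative f (at x) = frechet_derivative g (at x)" if "x \<in> S" for x
    using frechet_derivative_at that by blast
  have "Ck_on k S (\<lambda>x. frechet_derivative g (at x) v)" for v
    by (rule Suc.IH[of "\<lambda>x. frechet_derivative f (at x) v"]) (use Suc.prems(2) eq in auto)
  then show ?case using d unfolding Ck_on.simps differentiable_def by blast
qed

lemma Ck_on_SucD: "Ck_on (Suc k) S f \<Longrightarrow> Ck_on k S f"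
proof (induction k arbitrary: f)
  case 0
  then show ?case
    by (auto intro!: continuous_at_imp_continuous_on differentiable_imp_continuous_within)
next
  case (Suc k)
  then show ?case unfolding Ck_on.simps(2)[of "Suc k"] Ck_on.simps(2)[of k] by metis
qed

lemma Ck_on_continuous: "Ck_on k S f \<Longrightarrow> continuous_on S f"
  by (induction k) (auto dest: Ck_on_SucD simp del: Ck_on.simps(2))

lemma Ck_on_SucI:
  assumes "open S" "\<And>x. x \<in> S \<Longrightarrow> (f has_derivative f' x) (at x)" "\<And>v. Ck_on k S (\<lambda>x. f' x v)"
  shows "Ck_on (Suc k) S f"
proof -
  have eq: "f' x = frechet_derivative f (at x)" if "x \<in> S" for x
    using frechet_derivative_at assms(2) that by blast
  have "Ck_on k S (\<lambda>x. frechet_derivative f (at x) v)" for v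
    by (rule Ck_on_cong[OF assms(1) _ assms(3)[of v]]) (simp add: eq)
  then show ?thesis using assms(2) unfolding Ck_on.simps differentiable_def by blast
qed

lemma Ck_on_has_derivative:
  "Ck_on (Suc k) S f \<Longrightarrow> x \<in> S \<Longrightarrow> (f has_derivative frechet_derivative f (at x)) (at x)"
  by (simp add: frechet_derivative_works[symmetric])

lemma Ck_on_derivative: "Ck_on (Suc k) S f \<Longrightarrow> Ck_on k S (\<lambda>x. frechet_derivative f (at x) v)"
  by simp

lemma Ck_on_const: "open S \<Longrightarrow> Ck_on k S (\<lambda>x. c)"
proof (induction k arbitrary: c)
  case (Suc k)
  then show ?case by (intro Ck_on_SucI[where f' = "\<lambda>_ _. 0"]) auto
qed simp

lemma Ck_on_linear:
  assumes "open S" "bounded_linear f" shows "Ck_on k S f"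
proof (cases k)
  case 0
  then show ?thesis using assms by (simp add: linear_continuous_on)
next
  case (Suc m)
  then show ?thesis
    using assms by (auto intro!: Ck_on_SucI[where f' = "\<lambda>_. f"] Ck_on_const bounded_linear_imp_has_derivative
        simp del: Ck_on.simps)
qed

lemma Ck_on_add:
  assumes "open S" "Ck_on k S f" "Ck_on k S g" shows "Ck_on k S (\<lambda>x. f x + g x)"
  using assms(2,3)
proof (induction k arbitrary: f g)
  case 0
  then show ?case by (simp add: continuous_on_add)
next
  case (Suc k)
  show ?case
    by (rule Ck_on_SucI[OF assms(1) has_derivative_add[OF Suc.prems[THEN Ck_on_has_derivative]]])
       (use Suc.prems in \<open>auto intro!: Suc.IH\<close>)
qed

lemma Ck_on_mult:
  assumes "open S" "Ck_on k S f" "Ck_on k S g" shows "Ck_on k S (\<lambda>x. f x * g x)"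
  using assms(2,3)
proof (induction k arbitrary: f g)
  case 0
  then show ?case by (simp add: continuous_on_mult)
next
  case (Suc k)
  show ?case
    by (rule Ck_on_SucI[OF assms(1) has_derivative_mult[OF Suc.prems[THEN Ck_on_has_derivative]]])
       (intro Ck_on_add assms(1) Suc.IH Suc.prems[THEN Ck_on_SucD] Suc.prems[THEN Ck_on_derivative] | assumption)+
qed

text \<open>The derivative of 1/f is made of f' and 1/f itself, so the induction on the order closes
  with f fixed: the hypothesis supplies 1/f one order lower.\<close>

lemma Ck_on_inverse:
  assumes "open S" "Ck_on k S f" "\<And>x. x \<in> S \<Longrightarrow> f x \<noteq> 0" shows "Ck_on k S (\<lambda>x. inverse (f x))"
  using assms(2)
proof (induction k)
  case 0
  then show ?case using assms(3) by (auto intro!: continuous_on_inverse)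
next
  case (Suc k)
  have d: "((\<lambda>x. inverse (f x)) has_derivative
      (\<lambda>v. (- 1) * (inverse (f x) * frechet_derivative f (at x) v * inverse (f x)))) (at x)" if "x \<in> S" for x
    using Deriv.has_derivative_inverse[OF assms(3)[OF that] Ck_on_has_derivative[OF Suc.prems that]] by simp
  show ?case
    by (rule Ck_on_SucI[OF assms(1) d])
       (intro Ck_on_mult Ck_on_const assms(1) Suc.IH Suc.prems[THEN Ck_on_SucD] Suc.prems[THEN Ck_on_derivative] | assumption)+
qed

text \<open>The square root recurs in its own derivative, as an inverse; one order lower it is
  available by induction, and \<open>Ck_on_inverse\<close> applies to it.\<close>

lemma Ck_on_sqrt:
  assumes "open S" "Ck_on k S f" "\<And>x. x \<in> S \<Longrightarrow> f x > 0" shows "Ck_on k S (\<lambda>x. sqrt (f x))"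
  using assms(2)
proof (induction k)
  case 0
  then show ?case by (auto intro!: continuous_on_real_sqrt)
next
  case (Suc k)
  have d: "((\<lambda>x. sqrt (f x)) has_derivative
      (\<lambda>v. frechet_derivative f (at x) v * (inverse (sqrt (f x)) * inverse 2))) (at x)" if "x \<in> S" for x
    using DERIV_compose_FDERIV[OF DERIV_real_sqrt[OF assms(3)[OF that]] Ck_on_has_derivative[OF Suc.prems that]]
    unfolding divide_inverse .
  have nonzero: "sqrt (f x) \<noteq> 0" if "x \<in> S" for x using assms(3)[OF that] by simp
  show ?case
    by (rule Ck_on_SucI[OF assms(1) d])
       (intro Ck_on_mult Ck_on_inverse Ck_on_const assms(1) Suc.IH Suc.prems[THEN Ck_on_SucD]
          Suc.prems[THEN Ck_on_derivative] nonzero | assumption)+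
qed

text \<open>Serves the coefficients c1 and c2: as functions of r alone they agree locally with a
  smooth function on D restricted to a line of constant s.\<close>

lemma Ck_on_slice:
  fixes f :: "real \<times> real \<Rightarrow> real"
  assumes "open D" "Ck_on k D f" shows "Ck_on k {r. (r, c) \<in> D} (\<lambda>r. f (r, c))"
  using assms(2)
proof (induction k arbitrary: f)
  case 0
  then show ?case by (auto intro!: continuous_on_compose2[of D f] continuous_intros)
next
  case (Suc k)
  have "open ((\<lambda>r. (r, c)) -` D)"
    by (rule open_vimage[OF assms(1)]) (intro continuous_intros)
  then have op: "open {r. (r, c) \<in> D}" by (simp add: vimage_def)
  have d: "((\<lambda>r. f (r, c)) has_derivative (\<lambda>v. frechet_derivative f (at (r, c)) (v, 0))) (at r)"
    if "r \<in> {r. (r, c) \<in> D}" for r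
    by (rule has_derivative_compose[of "\<lambda>r. (r, c)" "\<lambda>v. (v, 0)"])
       (use that Ck_on_has_derivative[OF Suc.prems] in \<open>auto intro!: derivative_eq_intros\<close>)
  show ?case by (rule Ck_on_SucI[OF op d]) (use Suc in auto)
qed

text \<open>Smoothness in r is checked near each r separately, since no single value of s need
  belong to all slices.\<close>

lemma Ck_on_local:
  assumes "\<And>x. x \<in> S \<Longrightarrow> \<exists>U. open U \<and> x \<in> U \<and> Ck_on k U f"
  shows "Ck_on k S f"
  using assms
proof (induction k arbitrary: f)
  case 0
  then show ?case
    by (auto intro!: continuous_at_imp_continuous_on simp: continuous_on_eq_continuous_at) (metis continuous_on_eq_continuous_at)
next
  case (Suc k)
  show ?case unfolding Ck_on.simps
  proof safe
    show "f differentiable at x" if "x \<in> S" for x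
      using Suc.prems[OF that] by auto
    show "Ck_on k S (\<lambda>x. frechet_derivative f (at x) v)" for v
      by (rule Suc.IH) (use Suc.prems in fastforce)
  qed
qed

lemma smooth_on_add: "open S \<Longrightarrow> smooth_on S f \<Longrightarrow> smooth_on S g \<Longrightarrow> smooth_on S (\<lambda>x. f x + g x)"
  and smooth_on_mult: "open S \<Longrightarrow> smooth_on S f \<Longrightarrow> smooth_on S g \<Longrightarrow> smooth_on S (\<lambda>x. f x * g x)"
  and smooth_on_const: "open S \<Longrightarrow> smooth_on S (\<lambda>x. c)"
  and smooth_on_linear: "open S \<Longrightarrow> bounded_linear f \<Longrightarrow> smooth_on S f"
  and smooth_on_inverse: "open S \<Longrightarrow> smooth_on S f \<Longrightarrow> (\<And>x. x \<in> S \<Longrightarrow> f x \<noteq> 0) \<Longrightarrow> smooth_on S (\<lambda>x. inverse (f x))"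
  and smooth_on_sqrt: "open S \<Longrightarrow> smooth_on S f \<Longrightarrow> (\<And>x. x \<in> S \<Longrightarrow> f x > 0) \<Longrightarrow> smooth_on S (\<lambda>x. sqrt (f x))"
  and smooth_on_cong: "open S \<Longrightarrow> smooth_on S f \<Longrightarrow> (\<And>x. x \<in> S \<Longrightarrow> f x = g x) \<Longrightarrow> smooth_on S g"
  and smooth_on_derivative: "smooth_on S f \<Longrightarrow> smooth_on S (\<lambda>x. frechet_derivative f (at x) v)"
  and smooth_on_continuous: "smooth_on S f \<Longrightarrow> continuous_on S f"
  unfolding smooth_on_def
  by (auto intro: Ck_on_add Ck_on_mult Ck_on_const Ck_on_linear Ck_on_inverse Ck_on_sqrt Ck_on_continuous
      Ck_on_derivative[of _ S f] Ck_on_cong[of S f g] simp del: Ck_on.simps)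

lemma smooth_on_local: "(\<And>x. x \<in> S \<Longrightarrow> \<exists>U. open U \<and> x \<in> U \<and> smooth_on U f) \<Longrightarrow> smooth_on S f"
  unfolding smooth_on_def by (rule allI, rule Ck_on_local) blast

lemma smooth_on_slice:
  fixes f :: "real \<times> real \<Rightarrow> real"
  shows "open D \<Longrightarrow> smooth_on D f \<Longrightarrow> smooth_on {r. (r, c) \<in> D} (\<lambda>r. f (r, c))"
  unfolding smooth_on_def by (simp add: Ck_on_slice)

lemma smooth_on_diff:
  assumes "open S" "smooth_on S f" "smooth_on S g" shows "smooth_on S (\<lambda>x. f x - g x)"
  using smooth_on_add[OF assms(1,2) smooth_on_mult[OF assms(1) smooth_on_const[OF assms(1), of "- 1"] assms(3)]]
  by simp

lemma smooth_on_power: "open S \<Longrightarrow> smooth_on S f \<Longrightarrow> smooth_on S (\<lambda>x. f x ^ n)"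
  by (induction n) (auto intro: smooth_on_const smooth_on_mult)

lemma smooth_on_divide:
  "open S \<Longrightarrow> smooth_on S f \<Longrightarrow> smooth_on S g \<Longrightarrow> (\<And>x. x \<in> S \<Longrightarrow> g x \<noteq> 0) \<Longrightarrow> smooth_on S (\<lambda>x. f x / g x)"
  unfolding divide_inverse by (rule smooth_on_mult, assumption, assumption, rule smooth_on_inverse) auto

section \<open>The scalar coefficients on a slice\<close>

text \<open>One slice of constant r: \<open>f0\<close> to \<open>f4\<close> are phi and its
  s-derivatives up to order four, the order to which the T-tensor differentiates F^2.\<close>

locale radial_jet =
  fixes r :: real and I :: "real set" and f0 f1 f2 f3 f4 :: "real \<Rightarrow> real"
  assumes open_I: "open I" and I_less: "\<And>s. s \<in> I \<Longrightarrow> \<bar>s\<bar> < r"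
    and deriv: "\<And>s. s \<in> I \<Longrightarrow> (f0 has_real_derivative f1 s) (at s)"
      "\<And>s. s \<in> I \<Longrightarrow> (f1 has_real_derivative f2 s) (at s)"
      "\<And>s. s \<in> I \<Longrightarrow> (f2 has_real_derivative f3 s) (at s)"
      "\<And>s. s \<in> I \<Longrightarrow> (f3 has_real_derivative f4 s) (at s)"
    and f0_pos: "\<And>s. s \<in> I \<Longrightarrow> f0 s > 0"
    and nondeg: "\<And>s. s \<in> I \<Longrightarrow> f0 s - s * f1 s \<noteq> 0"
      "\<And>s. s \<in> I \<Longrightarrow> f0 s - s * f1 s + (r\<^sup>2 - s\<^sup>2) * f2 s \<noteq> 0"
begin

text \<open>
  With \<open>f0 = \<phi> r\<close>: \<open>G1\<close> is the derivative of \<open>G\<close>, the factor of the angular part of the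
  fundamental tensor, and \<open>G1' = - t K\<close> (see \<open>G1_deriv\<close>). This last identity is what makes the
  \<open>\<omega>\<omega>p\<close>-part of the T-tensor symmetric. \<open>R\<close> is the squared norm of \<open>\<omega>\<close>, and \<open>A4\<close>, \<open>B4\<close>, \<open>C4\<close>
  are the coefficients of the reduced T-tensor \<open>T_red\<close>.
\<close>

definition G :: "real \<Rightarrow> real" where "G t = f0 t * (f0 t - t * f1 t)"
definition G1 :: "real \<Rightarrow> real" where "G1 t = f1 t * (f0 t - t * f1 t) - t * f0 t * f2 t"
definition K :: "real \<Rightarrow> real" where "K t = 3 * f1 t * f2 t + f0 t * f3 t"
definition K1 :: "real \<Rightarrow> real" where
  "K1 t = 3 * (f2 t)\<^sup>2 + 4 * f1 t * f3 t + f0 t * f4 t"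

definition R :: "real \<Rightarrow> real" where "R t = r\<^sup>2 - t\<^sup>2"
definition Del :: "real \<Rightarrow> real" where "Del t = f0 t - t * f1 t + R t * f2 t"
definition M :: "real \<Rightarrow> real" where "M t = K t + 3 * G1 t / R t"
definition A4 :: "real \<Rightarrow> real" where
  "A4 t = K1 t - 6 * t * K t / R t - 3 * t * G1 t / (R t)\<^sup>2
     - 3 / 2 * R t * (M t)\<^sup>2 / (f0 t * Del t) + 4 * M t * f1 t / f0 t"
definition B4 :: "real \<Rightarrow> real" where
  "B4 t = - t * K t - t * G1 t / R t - R t * M t * G1 t / (2 * (f0 t * Del t)) - (G1 t)\<^sup>2 / G t
     + 2 * G1 t * f1 t / f0 t"
definition C4 :: "real \<Rightarrow> real" where
  "C4 t = - t * G1 t - R t * (G1 t)\<^sup>2 / (2 * (f0 t * Del t))"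

lemma R_pos: assumes "t \<in> I" shows "R t > 0"
proof -
  have "\<bar>t\<bar>\<^sup>2 < r\<^sup>2" using I_less[OF assms] by (intro power_strict_mono) auto
  then show ?thesis by (simp add: R_def)
qed

lemma G1_deriv: assumes "t \<in> I" shows "(G1 has_real_derivative - t * K t) (at t)"
  unfolding G1_def[abs_def]
  by (rule derivative_eq_intros deriv assms refl | rule DERIV_cong)+ (simp add: K_def algebra_simps)

lemma K_deriv: assumes "t \<in> I" shows "(K has_real_derivative K1 t) (at t)"
  unfolding K_def[abs_def]
  by (rule derivative_eq_intros deriv assms refl | rule DERIV_cong)+ (simp add: K1_def algebra_simps power2_eq_square)


text \<open>
  All coefficients become rational in \<open>\<psi> = f0' / (f0 - t f0')\<close> and its derivatives, up to powers
  of \<open>D1\<close>. The solutions of \<open>E1 = 0\<close> are \<open>\<psi> = - t / r\<^sup>2 + \<nu> (1 / t - t / r\<^sup>2)\<close>; the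
  nondegeneracy conditions say that \<open>w\<close> and \<open>N\<close> do not vanish.
\<close>

definition D1 :: "real \<Rightarrow> real" where "D1 t = f0 t - t * f1 t"
definition psi :: "real \<Rightarrow> real" where "psi t = f1 t / D1 t"
definition psi1 :: "real \<Rightarrow> real" where "psi1 t = f0 t * f2 t / (D1 t)\<^sup>2"
definition e :: "real \<Rightarrow> real" where "e t = psi t - t * psi1 t"
definition w :: "real \<Rightarrow> real" where "w t = 1 + t * psi t"
definition N :: "real \<Rightarrow> real" where "N t = w t + R t * psi1 t"
text \<open>\<open>psi2\<close> and \<open>psi3\<close> are the second and third derivatives of
  \<open>psi\<close>. They are written through \<open>K\<close> and \<open>K1\<close> because
  \<open>f3\<close> and \<open>f4\<close> enter \<open>A4\<close> and \<open>B4\<close> only in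
  these combinations.\<close>

definition psi2 :: "real \<Rightarrow> real" where "psi2 t = K t / (D1 t)\<^sup>2 - 2 * psi1 t * e t / w t"
definition psi3 :: "real \<Rightarrow> real" where
  "psi3 t = K1 t / (D1 t)\<^sup>2 + 2 * t * psi1 t / w t * (K t / (D1 t)\<^sup>2)
     - (2 * psi2 t * e t / w t - 2 * t * psi1 t * psi2 t / w t
        - 2 * psi1 t * e t * (psi t + t * psi1 t) / (w t)\<^sup>2)"
text \<open>Expands to 2 t + (r^2 + t^2) psi + t R psi', so E1 = 0 is a linear equation of first
  order for \<open>psi\<close>.\<close>

definition E1 :: "real \<Rightarrow> real" where "E1 t = 2 * t * N t + R t * e t"
definition E1' :: "real \<Rightarrow> real" where "E1' t = t * R t * psi2 t + 2 * N t"
definition E2 :: "real \<Rightarrow> real" where "E2 t = R t * psi2 t + e t"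

lemma D1_deriv: "t \<in> I \<Longrightarrow> (D1 has_real_derivative - t * f2 t) (at t)"
  unfolding D1_def[abs_def]
  by (rule derivative_eq_intros deriv refl | assumption | rule DERIV_cong)+ (simp add: algebra_simps)

context
  fixes t assumes t: "t \<in> I"
begin

lemma D1_nz: "D1 t \<noteq> 0" using nondeg(1)[OF t] by (simp add: D1_def)

lemma R_nz: "R t \<noteq> 0" using R_pos[OF t] by simp

lemma w_eq: "w t = f0 t / D1 t"
  using D1_nz by (simp add: w_def psi_def field_simps) (simp add: D1_def)

lemma w_nz: "w t \<noteq> 0" using f0_pos[OF t] D1_nz by (simp add: w_eq)

lemma jet_eq: "f0 t = w t * D1 t" "f1 t = psi t * D1 t" "f2 t = psi1 t * D1 t / w t"
  using D1_nz f0_pos[OF t] by (simp_all add: w_eq psi_def psi1_def field_simps power2_eq_square)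

lemma N_eq: "f0 t * Del t = N t * (D1 t)\<^sup>2"
proof -
  have "Del t = D1 t + R t * f2 t" by (simp add: Del_def D1_def)
  then show ?thesis using w_nz by (simp add: jet_eq N_def field_simps power2_eq_square)
qed

lemma N_nz: "N t \<noteq> 0"
proof -
  have "f0 t * Del t \<noteq> 0" using f0_pos[OF t] nondeg(2)[OF t] by (simp add: Del_def R_def)
  then show ?thesis unfolding N_eq by auto
qed

lemma psi_deriv: "(psi has_real_derivative psi1 t) (at t)"
  unfolding psi_def[abs_def]
  apply (rule derivative_eq_intros deriv D1_deriv refl t D1_nz | rule DERIV_cong)+
  using D1_nz apply (simp add: psi1_def field_simps power2_eq_square)
  apply (simp add: D1_def algebra_simps)
  done

lemma G1_eq: "G1 t = (D1 t)\<^sup>2 * e t"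
  using D1_nz unfolding G1_def by (simp add: psi1_def psi_def e_def field_simps power2_eq_square) (simp add: D1_def algebra_simps)

lemma K_eq: "K t = (D1 t)\<^sup>2 * (psi2 t + 2 * psi1 t * e t / w t)"
  using D1_nz by (simp add: psi2_def)

lemma G_eq: "G t = w t * (D1 t)\<^sup>2"
proof -
  have "G t = f0 t * D1 t" by (simp add: G_def D1_def)
  then show ?thesis by (simp add: jet_eq(1) power2_eq_square)
qed

lemma M_eq: "M t = (D1 t)\<^sup>2 * (psi2 t + 2 * psi1 t * e t / w t + 3 * e t / R t)"
  by (simp add: M_def K_eq G1_eq algebra_simps)

lemma psi1_deriv: "(psi1 has_real_derivative psi2 t) (at t)"
  unfolding psi1_def[abs_def]
  apply (rule derivative_eq_intros deriv D1_deriv refl t D1_nz | rule DERIV_cong)+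
  using D1_nz apply simp
  using D1_nz f0_pos[OF t] 
  apply (simp add: psi2_def K_def w_eq e_def)
  apply (simp add: psi1_def psi_def field_simps)
  done

lemma e_deriv: "(e has_real_derivative - t * psi2 t) (at t)"
  unfolding e_def[abs_def]
  by (rule derivative_eq_intros psi_deriv psi1_deriv refl)+ simp

lemma w_deriv: "(w has_real_derivative psi t + t * psi1 t) (at t)"
  unfolding w_def[abs_def]
  by (rule derivative_eq_intros psi_deriv psi1_deriv refl)+ simp

lemma R_deriv: "(R has_real_derivative - 2 * t) (at t)"
  unfolding R_def[abs_def]
  by (rule derivative_eq_intros refl)+ simp

lemma psi2_deriv: "(psi2 has_real_derivative psi3 t) (at t)"
proof -
  have 1: "((\<lambda>z. K z / (D1 z)\<^sup>2) has_real_derivative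
      K1 t / (D1 t)\<^sup>2 + 2 * t * psi1 t / w t * (K t / (D1 t)\<^sup>2)) (at t)"
    by (rule DERIV_cong, rule DERIV_divide[OF K_deriv[OF t] DERIV_power[OF D1_deriv[OF t], of 2]])
       (use D1_nz w_nz in \<open>simp_all add: jet_eq(3) field_simps power2_eq_square\<close>)
  have 2: "((\<lambda>z. 2 * psi1 z * e z / w z) has_real_derivative
      2 * psi2 t * e t / w t - 2 * t * psi1 t * psi2 t / w t
        - 2 * psi1 t * e t * (psi t + t * psi1 t) / (w t)\<^sup>2) (at t)"
    by (rule DERIV_cong, rule DERIV_divide[OF DERIV_mult[OF DERIV_cmult[OF psi1_deriv] e_deriv] w_deriv w_nz])
       (use w_nz in \<open>simp add: field_simps power2_eq_square\<close>)
  show ?thesis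
    using DERIV_diff[OF 1 2] by (simp add: psi2_def[abs_def] psi3_def)
qed

lemma N_deriv: "(N has_real_derivative e t + R t * psi2 t) (at t)"
  unfolding N_def[abs_def]
  by (rule derivative_eq_intros w_deriv R_deriv psi1_deriv refl)+ (simp add: e_def algebra_simps)

lemma E1_deriv: "(E1 has_real_derivative E1' t) (at t)"
  unfolding E1_def[abs_def]
  by (rule derivative_eq_intros N_deriv R_deriv e_deriv refl)+ (simp add: E1'_def algebra_simps)

lemma E1'_deriv: "(E1' has_real_derivative t * R t * psi3 t + (3 * R t - 2 * t\<^sup>2) * psi2 t + 2 * e t) (at t)"
  unfolding E1'_def[abs_def]
  by (rule derivative_eq_intros N_deriv R_deriv psi2_deriv refl)+ (simp add: algebra_simps power2_eq_square)

lemma E2_deriv: "(E2 has_real_derivative R t * psi3 t - 3 * t * psi2 t) (at t)"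
  unfolding E2_def[abs_def]
  by (rule derivative_eq_intros e_deriv R_deriv psi2_deriv refl)+ (simp add: algebra_simps power2_eq_square)

lemma B4_eq: "B4 t = (D1 t)\<^sup>2 * (- E1 t * E2 t / (2 * N t * R t))"
proof -
  have psi: "psi t = e t + t * psi1 t" by (simp add: e_def)
  have *: "- t * k - t * e' / R' - R' * (k + 3 * e' / R') * e' / (2 * N') - e'\<^sup>2 / w' + 2 * e' * p / w'
     = - (2 * t * N' + R' * e') * (R' * q2 + e') / (2 * N' * R')"
    if "k = q2 + 2 * q1 * e' / w'" "e' = p - t * q1" "w' = 1 + t * p" "N' = w' + R' * q1" "R' \<noteq> 0" "N' \<noteq> 0" "w' \<noteq> 0"
    for k e' R' N' w' p q1 q2 :: real
  proof -
    \<comment> \<open>Trading psi and psi' for e and N makes w cancel, and what is left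
      factors.\<close>
    have p: "p = e' + t * q1" and q1: "q1 = (N' - w') / R'" using that by auto
    show ?thesis unfolding that(1) p q1 using that(5-7)
      by (simp add: divide_simps) (simp add: algebra_simps power2_eq_square)
  qed
  have "B4 t = (D1 t)\<^sup>2 * (- t * (psi2 t + 2 * psi1 t * e t / w t) - t * e t / R t
     - R t * ((psi2 t + 2 * psi1 t * e t / w t) + 3 * e t / R t) * e t / (2 * N t) - (e t)\<^sup>2 / w t
     + 2 * e t * psi t / w t)"
    unfolding B4_def N_eq
    unfolding M_eq G1_eq G_eq K_eq jet_eq(1,2)
    using D1_nz w_nz N_nz R_nz
    by (simp add: divide_simps) (simp add: algebra_simps power2_eq_square power4_eq_xxxx)
  also have "\<dots> = (D1 t)\<^sup>2 * (- (2 * t * N t + R t * e t) * (R t * psi2 t + e t) / (2 * N t * R t))"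
    by (subst *[OF refl e_def w_def N_def R_nz N_nz w_nz]) (rule refl)
  finally show ?thesis unfolding E1_def E2_def .
qed

lemma C4_eq: "C4 t = - (D1 t)\<^sup>2 * e t * E1 t / (2 * N t)"
  unfolding C4_def N_eq G1_eq E1_def using D1_nz N_nz 
  by (simp add: field_simps power2_eq_square)

text \<open>Subtracting t E2 from E1' leaves 2 N - t e. With E1 = 0 this gives r^2 e = 0, hence N =
  0, against nondegeneracy.\<close>

lemma E_disjoint: "E1 t = 0 \<Longrightarrow> E1' t = 0 \<Longrightarrow> E2 t \<noteq> 0"
proof
  assume E: "E1 t = 0" "E1' t = 0" "E2 t = 0"
  have "2 * N t = t * e t" using E(2,3) by (simp add: E1'_def E2_def mult.assoc) algebra
  then have "(t\<^sup>2 + R t) * e t = 0" using E(1) by (simp add: E1_def algebra_simps power2_eq_square)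
  moreover have "t\<^sup>2 + R t > 0" using R_pos[OF t] by (simp add: add_nonneg_pos)
  ultimately have "e t = 0" by simp
  then show False using \<open>2 * N t = t * e t\<close> N_nz by simp
qed

text \<open>Every term of \<open>A4\<close> carries \<open>D1\<close> squared, so its vanishing is a
  question about \<open>psi\<close> alone.\<close>

lemma A4_eq: "A4 t = (D1 t)\<^sup>2 * (
    (psi3 t + 2 * psi2 t * e t / w t - 2 * t * psi1 t * psi2 t / w t
        - 2 * psi1 t * e t * (psi t + t * psi1 t) / (w t)\<^sup>2)
    - 2 * t * psi1 t / w t * (psi2 t + 2 * psi1 t * e t / w t)
    - 6 * t * (psi2 t + 2 * psi1 t * e t / w t) / R t - 3 * t * e t / (R t)\<^sup>2
    - 3 / 2 * R t * (psi2 t + 2 * psi1 t * e t / w t + 3 * e t / R t)\<^sup>2 / N t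
    + 4 * (psi2 t + 2 * psi1 t * e t / w t + 3 * e t / R t) * psi t / w t)"
proof -
  have K1: "K1 t = (D1 t)\<^sup>2 * ((psi3 t + 2 * psi2 t * e t / w t - 2 * t * psi1 t * psi2 t / w t
        - 2 * psi1 t * e t * (psi t + t * psi1 t) / (w t)\<^sup>2)
    - 2 * t * psi1 t / w t * (psi2 t + 2 * psi1 t * e t / w t))"
    unfolding psi3_def K_eq using D1_nz by simp
  have *: "d\<^sup>2 * A - 6 * t * (d\<^sup>2 * k) / R' - 3 * t * (d\<^sup>2 * b) / R'\<^sup>2 - 3 / 2 * R' * (d\<^sup>2 * m)\<^sup>2 / (n * d\<^sup>2)
     + 4 * (d\<^sup>2 * m) * (q * d) / (w' * d)
     = d\<^sup>2 * (A - 6 * t * k / R' - 3 * t * b / R'\<^sup>2 - 3 / 2 * R' * m\<^sup>2 / n + 4 * m * q / w')"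
    if "d \<noteq> 0" for d A k R' b m n q w' :: real
    using that by (simp add: algebra_simps power2_eq_square)
  show ?thesis
    unfolding A4_def N_eq
    unfolding M_eq G1_eq K1 K_eq jet_eq(1,2) by (rule *[OF D1_nz])
qed

text \<open>The second hypothesis says that the derivative of \<open>E2\<close> vanishes
  (\<open>E2_deriv\<close>); it is there because \<open>A4\<close> involves
  \<open>psi3\<close>.\<close>

lemma A4_eq_0_of_E2:
  assumes "E2 t = 0" "R t * psi3 t = 3 * t * psi2 t"
  shows "A4 t = 0"
proof -
  have e': "e t = - R t * psi2 t" and q3: "psi3 t = 3 * t * psi2 t / R t"
    using assms R_nz by (simp_all add: E2_def field_simps)
  have psi: "psi t = t * psi1 t - R t * psi2 t" using e' by (simp add: e_def algebra_simps)
  have q1: "psi1 t = (N t - w t) / R t" using R_nz by (simp add: N_def)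
  have ww: "w t = 1 + t * psi t" by (rule w_def)
  \<comment> \<open>The factor N appearing here cancels the denominator N under the square in
    \<open>A4_eq\<close>.\<close>
  have M: "psi2 t + 2 * psi1 t * e t / w t + 3 * e t / R t = - 2 * psi2 t * N t / w t"
    using w_nz R_nz unfolding e' q1 by (simp add: divide_simps) (simp add: algebra_simps)
  show ?thesis unfolding A4_eq M
    unfolding q3 e' psi q1 using w_nz R_nz N_nz 
    apply (simp add: divide_simps)
    apply (simp add: algebra_simps power2_eq_square)
    done
qed

text \<open>At t = 0 the value of \<open>E1'\<close> is 2 N. This matches the pole 1 / t in the
  solutions of E1 = 0.\<close>

lemma E1_t_nz: assumes "E1 t = 0" "E1' t = 0" shows "t \<noteq> 0"
proof
  assume "t = 0"
  then show False using assms N_nz by (simp add: E1'_def)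
qed

text \<open>The third hypothesis says that the second derivative of \<open>E1\<close> vanishes
  (\<open>E1'_deriv\<close>). The three equations express \<open>e\<close>, \<open>psi2\<close> and
  \<open>psi3\<close> through \<open>N\<close>.\<close>

lemma A4_eq_0_of_E1:
  assumes "E1 t = 0" "E1' t = 0" "t * R t * psi3 t + (3 * R t - 2 * t\<^sup>2) * psi2 t + 2 * e t = 0"
  shows "A4 t = 0"
proof -
  note t0 = E1_t_nz[OF assms(1,2)]
  have e': "e t = - 2 * t * N t / R t" and q2: "psi2 t = - 2 * N t / (t * R t)"
    using assms(1,2) R_nz t0 by (simp_all add: E1_def E1'_def field_simps)
  have q3: "psi3 t = - ((3 * R t - 2 * t\<^sup>2) * psi2 t + 2 * e t) / (t * R t)"
    using assms(3) R_nz t0 by (simp add: field_simps)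
  have q1: "psi1 t = (N t - w t) / R t" using R_nz by (simp add: N_def)
  have psi: "psi t = e t + t * psi1 t" by (simp add: e_def)
  show ?thesis unfolding A4_eq
    unfolding q3 psi unfolding e' q1 q2 using w_nz R_nz N_nz t0
    apply (simp add: divide_simps)
    apply (simp add: algebra_simps power2_eq_square power4_eq_xxxx)
    done
qed

end
end

section \<open>The T-tensor of a spherically symmetric metric\<close>

text \<open>A relation, unlike \<open>partial\<close>: values are built up by introduction rules,
  and differentiability is carried along.\<close>

definition has_partial :: "(real^'n::finite \<Rightarrow> real) \<Rightarrow> 'n \<Rightarrow> real \<Rightarrow> real^'n \<Rightarrow> bool" where
  "has_partial f k d y \<longleftrightarrow> (\<exists>f'. (f has_derivative f') (at y) \<and> f' (axis k 1) = d)"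

lemma has_partial_eq: "has_partial f k d y \<Longrightarrow> d = d' \<Longrightarrow> has_partial f k d' y"
  by simp

lemma partial_eqI: "has_partial f k d y \<Longrightarrow> partial k f y = d"
  unfolding has_partial_def partial_def using frechet_derivative_at by metis

text \<open>For iterated derivatives: the inner one has its closed form only on an open set, and is
  replaced there before being differentiated again.\<close>

lemma has_partial_transform:
  assumes "has_partial f k d y" "open S" "y \<in> S" "\<And>z. z \<in> S \<Longrightarrow> f z = g z"
  shows "has_partial g k d y"
proof -
  obtain f' where "(f has_derivative f') (at y)" "f' (axis k 1) = d"
    using assms(1) unfolding has_partial_def by auto
  then show ?thesis unfolding has_partial_def
    using has_derivative_transform_within_open[OF _ assms(2,3)] assms(4) by blast
qed

lemma has_partial_const: "has_partial (\<lambda>z. c) k 0 y"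
  unfolding has_partial_def by (intro exI[of _ "\<lambda>_. 0"]) auto

lemma has_partial_add:
  "has_partial f k a y \<Longrightarrow> has_partial g k b y \<Longrightarrow> has_partial (\<lambda>z. f z + g z) k (a + b) y"
  unfolding has_partial_def by (fastforce intro: has_derivative_add)

lemma has_partial_diff:
  "has_partial f k a y \<Longrightarrow> has_partial g k b y \<Longrightarrow> has_partial (\<lambda>z. f z - g z) k (a - b) y"
  unfolding has_partial_def by (fastforce intro: has_derivative_diff)

lemma has_partial_mult:
  fixes f g :: "real^'n::finite \<Rightarrow> real"
  assumes "has_partial f k a y" "has_partial g k b y"
  shows "has_partial (\<lambda>z. f z * g z) k (f y * b + a * g y) y"
proof -
  obtain f' g' where "(f has_derivative f') (at y)" "f' (axis k 1) = a"
      "(g has_derivative g') (at y)" "g' (axis k 1) = b"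
    using assms unfolding has_partial_def by auto
  then show ?thesis unfolding has_partial_def
    by (intro exI[of _ "\<lambda>v. f y * g' v + f' v * g y"] conjI has_derivative_mult) auto
qed

lemma has_partial_chain:
  assumes "has_partial f k a y" "(\<phi> has_real_derivative c) (at (f y))"
  shows "has_partial (\<lambda>z. \<phi> (f z)) k (c * a) y"
proof -
  obtain f' where f': "(f has_derivative f') (at y)" "f' (axis k 1) = a"
    using assms unfolding has_partial_def by auto
  have "((\<lambda>z. \<phi> (f z)) has_derivative (\<lambda>v. c * f' v)) (at y)"
    by (rule has_derivative_compose[OF f'(1), of \<phi> "\<lambda>v. c * v"])
       (use assms(2) in \<open>simp add: has_field_derivative_def\<close>)
  then show ?thesis unfolding has_partial_def using f'(2) by blast
qed

lemma has_partial_nth: "has_partial (\<lambda>z. z $ i) k (if i = k then 1 else 0) y"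
proof -
  have "((\<lambda>z. z $ i) has_derivative (\<lambda>v. v $ i)) (at y)"
    by (rule bounded_linear_imp_has_derivative[OF bounded_linear_vec_nth])
  then show ?thesis unfolding has_partial_def by (intro exI[of _ "\<lambda>v. v $ i"] conjI) (simp_all add: axis_def)
qed

lemma has_partial_inner: "has_partial (\<lambda>z. x \<bullet> z) k (x $ k) y"
proof -
  have "((\<lambda>z. x \<bullet> z) has_derivative (\<lambda>v. x \<bullet> v)) (at y)"
    by (rule bounded_linear_imp_has_derivative[OF bounded_linear_inner_right])
  then show ?thesis unfolding has_partial_def by (intro exI[of _ "\<lambda>v. x \<bullet> v"] conjI) (simp_all add: inner_axis)
qed

lemma has_partial_norm: assumes "y \<noteq> 0" shows "has_partial norm k (y $ k / norm y) y"
proof -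
  have "(norm has_derivative (\<lambda>v. v \<bullet> sgn y)) (at y)"
    using has_derivative_norm[OF assms] by (simp add: inner_commute)
  then show ?thesis unfolding has_partial_def
    by (intro exI[of _ "\<lambda>v. v \<bullet> sgn y"] conjI)
       (simp_all add: sgn_div_norm inner_commute inner_axis divide_inverse mult.commute)
qed

lemma has_partial_divide:
  fixes f g :: "real^'n::finite \<Rightarrow> real"
  assumes "has_partial f k a y" "has_partial g k b y" "g y \<noteq> 0"
  shows "has_partial (\<lambda>z. f z / g z) k ((a * g y - f y * b) / (g y)\<^sup>2) y"
proof -
  have "has_partial (\<lambda>z. inverse (g z)) k (- inverse ((g y)\<^sup>2) * b) y"
    by (rule has_partial_chain[OF assms(2)])
       (use assms(3) in \<open>auto intro!: derivative_eq_intros simp: power2_eq_square\<close>)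
  from has_partial_mult[OF assms(1) this] show ?thesis
    using assms(3) by (simp add: field_simps power2_eq_square)
qed

definition kron :: "'n \<Rightarrow> 'n \<Rightarrow> real" where "kron i j = (if i = j then 1 else 0)"

lemma sum_kron: "(\<Sum>r\<in>UNIV. kron (j::'n::finite) r * f r) = f j"
  unfolding kron_def by (simp add: if_distrib if_distribR sum.delta cong: if_cong)

lemma kron_commute: "kron i j = kron j i"
  by (auto simp: kron_def)

section \<open>The fundamental tensor and the Cartan tensor at fixed x\<close>

locale spherical_jet = radial_jet "norm x" I f0 f1 f2 f3 f4
  for x :: "real^'n::finite" and I :: "real set" and f0 f1 f2 f3 f4 :: "real \<Rightarrow> real" +
  fixes F :: "real^'n \<Rightarrow> real^'n \<Rightarrow> real"
  assumes F: "\<And>z. F x z = norm z * f0 (x \<bullet> z / norm z)"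
begin

definition s :: "real^'n \<Rightarrow> real" where "s z = x \<bullet> z / norm z"
definition eta :: "'n \<Rightarrow> real^'n \<Rightarrow> real" where "eta i z = z $ i / norm z"
text \<open>The component of x orthogonal to y, which is also |y| times the y-gradient of s
  (\<open>has_partial_s\<close>).\<close>

definition om :: "'n \<Rightarrow> real^'n \<Rightarrow> real" where "om i z = x $ i - s z * eta i z"
definition h :: "'n \<Rightarrow> 'n \<Rightarrow> real^'n \<Rightarrow> real" where "h i j z = kron i j - eta i z * eta j z"
definition Y :: "(real^'n) set" where "Y = {z. z \<noteq> 0 \<and> s z \<in> I}"

definition lam :: "'n \<Rightarrow> real^'n \<Rightarrow> real" where
  "lam i z = f0 (s z) * eta i z + f1 (s z) * om i z"

lemma open_Y: "open Y"
proof -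
  have "continuous_on (- {0}) s"
    unfolding s_def[abs_def] by (intro continuous_intros) auto
  then have "open (- {0} \<inter> s -` I)"
    by (rule continuous_open_preimage) (auto simp: open_I)
  moreover have "Y = - {0} \<inter> s -` I" by (auto simp: Y_def)
  ultimately show ?thesis by simp
qed

lemma has_partial_u: "y \<in> Y \<Longrightarrow> has_partial norm k (eta k y) y"
  unfolding eta_def using has_partial_norm by (auto simp: Y_def)

lemma has_partial_s: assumes "y \<in> Y" shows "has_partial s k (om k y / norm y) y"
proof -
  have y: "y \<noteq> 0" using assms by (auto simp: Y_def)
  show ?thesis unfolding s_def[abs_def]
    by (rule has_partial_eq, rule has_partial_divide[OF has_partial_inner has_partial_u[OF assms]])
       (use y in \<open>simp_all add: om_def s_def eta_def field_simps power2_eq_square\<close>)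
qed

lemma has_partial_eta: assumes "y \<in> Y" shows "has_partial (eta i) k (h i k y / norm y) y"
proof -
  have y: "y \<noteq> 0" using assms by (auto simp: Y_def)
  show ?thesis unfolding eta_def[abs_def]
    by (rule has_partial_eq, rule has_partial_divide[OF has_partial_nth has_partial_u[OF assms]])
       (use y in \<open>simp_all add: h_def kron_def eta_def field_simps power2_eq_square\<close>)
qed

lemma om_abs: "om i = (\<lambda>z. x $ i - s z * eta i z)" and h_abs: "h i j = (\<lambda>z. kron i j - eta i z * eta j z)"
  by (auto simp: om_def h_def)

lemma has_partial_om: assumes "y \<in> Y"
  shows "has_partial (om i) k (- (om k y * eta i y + s y * h i k y) / norm y) y"
  by (subst om_abs[of i]) (rule has_partial_eq, (rule has_partial_diff has_partial_const has_partial_mult has_partial_s has_partial_eta assms)+,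
     simp add: om_def divide_inverse algebra_simps)

lemma has_partial_h: assumes "y \<in> Y"
  shows "has_partial (h i j) k (- (h i k y * eta j y + eta i y * h j k y) / norm y) y"
  by (subst h_abs[of i j]) (rule has_partial_eq, (rule has_partial_diff has_partial_const has_partial_mult has_partial_eta assms)+,
     simp add: divide_inverse algebra_simps)

lemma has_partial_f: assumes "y \<in> Y" "(f has_real_derivative f') (at (s y))"
  shows "has_partial (\<lambda>z. f (s z)) k (f' * (om k y / norm y)) y"
  by (rule has_partial_chain[OF has_partial_s[OF assms(1)] assms(2)])

lemma Y_D: assumes "y \<in> Y" shows "y \<noteq> 0" "norm y \<noteq> 0" "norm y > 0" "s y \<in> I"
  using assms by (auto simp: Y_def)

lemmas has_partial_f0 = has_partial_f[OF _ deriv(1)[OF Y_D(4)]]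
lemmas has_partial_f1 = has_partial_f[OF _ deriv(2)[OF Y_D(4)]]
lemmas has_partial_f2 = has_partial_f[OF _ deriv(3)[OF Y_D(4)]]

lemmas has_partial_G1 = has_partial_f[OF _ G1_deriv[OF Y_D(4)]]
lemmas has_partial_K = has_partial_f[OF _ K_deriv[OF Y_D(4)]]

lemmas has_partial_intros = has_partial_const has_partial_add has_partial_diff has_partial_mult
  has_partial_f0 has_partial_f1 has_partial_f2 has_partial_G1 has_partial_K has_partial_u has_partial_s has_partial_eta has_partial_om has_partial_h

lemma has_partial_F: assumes "y \<in> Y" shows "has_partial (F x) k (lam k y) y"
proof -
  have "has_partial (\<lambda>z. norm z * f0 (s z)) k (lam k y) y"
    by (rule has_partial_eq, (rule has_partial_intros assms)+)
       (use Y_D[OF assms] in \<open>simp add: lam_def field_simps\<close>)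
  then show ?thesis by (simp add: F s_def ext[of "F x"])
qed

lemma ell_eq: "y \<in> Y \<Longrightarrow> ell F x y i = lam i y"
  unfolding ell_def by (rule partial_eqI[OF has_partial_F])

lemma partial_square:
  assumes "y \<in> Y"
  shows "partial j (\<lambda>z. (F x z)\<^sup>2) y = 2 * (norm y * (f0 (s y) * lam j y))"
proof -
  have "has_partial (\<lambda>z. F x z * F x z) j (2 * (norm y * (f0 (s y) * lam j y))) y"
    by (rule has_partial_eq, (rule has_partial_intros has_partial_F assms)+) (simp add: F s_def)
  then show ?thesis by (simp add: power2_eq_square partial_eqI)
qed

text \<open>The Hessian of F^2 / 2: the square of \<open>lam\<close> plus F times the y-Hessian of
  F, the latter computed in \<open>has_partial_lam\<close>.\<close>

definition g :: "'n \<Rightarrow> 'n \<Rightarrow> real^'n \<Rightarrow> real" where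
  "g i j z = lam i z * lam j z + G (s z) * h i j z + f0 (s z) * f2 (s z) * om i z * om j z"

lemma has_partial_lam: assumes "y \<in> Y"
  shows "has_partial (lam i) k (((f0 (s y) - s y * f1 (s y)) * h i k y + f2 (s y) * om i y * om k y) / norm y) y"
  unfolding lam_def[abs_def]
  by (rule has_partial_eq, (rule has_partial_intros assms)+) (use Y_D[OF assms] in \<open>simp add: field_simps\<close>)

lemma fund_eq: assumes "y \<in> Y" shows "fund_tensor F x y $ i $ j = g i j y"
proof -
  have "has_partial (\<lambda>z. 2 * (norm z * (f0 (s z) * lam j z))) i (2 * g i j y) y"
    by (rule has_partial_eq, (rule has_partial_intros has_partial_lam assms)+)
       (use Y_D[OF assms] in \<open>simp add: g_def lam_def G_def h_def kron_commute field_simps\<close>)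
  then have "has_partial (partial j (\<lambda>z. (F x z)\<^sup>2)) i (2 * g i j y) y"
    by (rule has_partial_transform[OF _ open_Y assms]) (simp add: partial_square)
  then show ?thesis by (simp add: fund_tensor_def partial_eqI)
qed

definition c :: "'n \<Rightarrow> 'n \<Rightarrow> 'n \<Rightarrow> real^'n \<Rightarrow> real" where
  "c i j k z = G1 (s z) * (om i z * h j k z + om j z * h i k z + om k z * h i j z)
     + K (s z) * om i z * om j z * om k z"

lemma h_commute: "h i j z = h j i z" by (simp add: h_def kron_commute)

lemma has_partial_G: assumes "y \<in> Y" shows "has_partial (\<lambda>z. G (s z)) k (G1 (s y) * (om k y / norm y)) y"
proof -
  have "(G has_real_derivative G1 (s y)) (at (s y))"
    unfolding G_def[abs_def]
    by (rule derivative_eq_intros deriv Y_D[OF assms] refl | rule DERIV_cong)+ (simp add: G1_def algebra_simps)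
  from has_partial_f[OF assms this] show ?thesis .
qed

lemma cartan_eq: assumes "y \<in> Y" shows "cartan F x y i j k = c i j k y / (2 * norm y)"
proof -
  have "has_partial (g i j) k (c i j k y / norm y) y"
    unfolding g_def[abs_def]
    apply (rule has_partial_eq, (rule has_partial_intros has_partial_lam has_partial_G assms)+)
    using Y_D[OF assms] apply (simp add: c_def)
    apply (simp add: divide_simps)
    apply (simp add: lam_def G_def G1_def K_def h_commute[of k] h_commute[of j i])
    apply (simp add: algebra_simps)
    done
  then have "has_partial (\<lambda>z. fund_tensor F x z $ i $ j) k (c i j k y / norm y) y"
    by (rule has_partial_transform[OF _ open_Y assms]) (simp add: fund_eq)
  then show ?thesis by (simp add: cartan_def partial_eqI)
qed

end

section \<open>The inverse metric and contractions of the Cartan tensor\<close>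

lemma matrix_inv_eqI:
  fixes A B :: "real^'n::finite^'n"
  assumes "A ** B = mat 1"
  shows "matrix_inv A = B"
proof -
  \<comment> \<open>\<open>matrix_inv\<close> is a choice among two-sided inverses; for square
    matrices a right inverse is one of them.\<close>
  have "A ** B = mat 1 \<and> B ** A = mat 1" using assms by (simp add: matrix_left_right_inverse)
  then have "A ** matrix_inv A = mat 1 \<and> matrix_inv A ** A = mat 1"
    unfolding matrix_inv_def by (rule someI)
  then have "matrix_inv A ** (A ** B) = B" by (simp add: matrix_mul_assoc)
  then show ?thesis by (simp add: assms)
qed

text \<open>Takes functions of an index, so that slots of tensors can be contracted directly;
  \<open>pair_linear\<close> and the table \<open>contractions\<close> then evaluate such sums by
  rewriting.\<close>

definition pair :: "('n::finite \<Rightarrow> real) \<Rightarrow> ('n \<Rightarrow> real) \<Rightarrow> real" where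
  "pair a b = (\<Sum>k\<in>UNIV. a k * b k)"

lemma pair_commute: "pair a b = pair b a"
  by (simp add: pair_def mult.commute)

lemma pair_linear:
  "pair a (\<lambda>k. b k + d k) = pair a b + pair a d"
  "pair a (\<lambda>k. b k - d k) = pair a b - pair a d"
  "pair a (\<lambda>k. - b k) = - pair a b"
  "pair a (\<lambda>k. t * b k) = t * pair a b"
  "pair a (\<lambda>k. b k * t) = pair a b * t"
  "pair a (\<lambda>k. b k / t) = pair a b / t"
  "pair (\<lambda>k. b k + d k) a = pair b a + pair d a"
  "pair (\<lambda>k. b k - d k) a = pair b a - pair d a"
  "pair (\<lambda>k. - b k) a = - pair b a"
  "pair (\<lambda>k. t * b k) a = t * pair b a"
  "pair (\<lambda>k. b k * t) a = pair b a * t"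
  "pair (\<lambda>k. b k / t) a = pair b a / t"
  by (simp_all add: pair_def algebra_simps sum.distrib sum_subtractf sum_negf sum_distrib_left
      sum_divide_distrib)

context spherical_jet
begin

definition p :: "'n \<Rightarrow> 'n \<Rightarrow> real^'n \<Rightarrow> real" where
  "p i j z = h i j z - om i z * om j z / R (s z)"
definition om_tilde :: "'n \<Rightarrow> real^'n \<Rightarrow> real" where
  "om_tilde i z = om i z - f1 (s z) * R (s z) / f0 (s z) * eta i z"
text \<open>
  \<open>om_tilde\<close> is \<open>\<omega>\<close> made orthogonal to \<open>y\<close> with respect to \<open>g\<close>, so \<open>\<eta>\<close>, \<open>om_tilde\<close> and the
  range of \<open>p\<close> diagonalise \<open>g\<close>.
\<close>

definition g_inv :: "'n \<Rightarrow> 'n \<Rightarrow> real^'n \<Rightarrow> real" where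
  "g_inv i j z = eta i z * eta j z / (f0 (s z))\<^sup>2 + om_tilde i z * om_tilde j z / (f0 (s z) * Del (s z) * R (s z))
     + p i j z / G (s z)"

lemma nonzero: assumes "y \<in> Y"
  shows "f0 (s y) \<noteq> 0" "Del (s y) \<noteq> 0" "R (s y) \<noteq> 0" "G (s y) \<noteq> 0" "norm y \<noteq> 0"
  using f0_pos[of "s y"] nondeg[of "s y"] R_pos[of "s y"] Y_D[OF assms]
  by (auto simp: Del_def R_def G_def)

lemma p_commute: "p i j z = p j i z" by (simp add: p_def h_commute mult.commute)

lemma pair_p: "pair (\<lambda>k. p i k y) v = v i - eta i y * pair (\<lambda>k. eta k y) v
    - om i y * pair (\<lambda>k. om k y) v / R (s y)"
proof -
  have "pair (kron i) v = v i" by (simp add: pair_def sum_kron)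
  then show ?thesis by (simp add: p_def h_def pair_linear)
qed

lemma pair_x_eta: "pair (\<lambda>k. x $ k) (\<lambda>k. eta k y) = s y"
  by (simp add: pair_def eta_def s_def inner_vec_def sum_divide_distrib)

lemma pair_x_x: "pair (\<lambda>k. x $ k) (\<lambda>k. x $ k) = (norm x)\<^sup>2"
  by (simp add: pair_def power2_norm_eq_inner inner_vec_def)

context
  fixes y assumes y: "y \<in> Y"
begin

lemma pair_eta_eta: "pair (\<lambda>k. eta k y) (\<lambda>k. eta k y) = 1"
proof -
  have "pair (\<lambda>k. eta k y) (\<lambda>k. eta k y) = (y \<bullet> y) / (norm y * norm y)"
    by (simp add: pair_def eta_def inner_vec_def sum_divide_distrib)
  then show ?thesis using nonzero[OF y] by (simp add: dot_square_norm power2_eq_square)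
qed

lemma pair_om_eta: "pair (\<lambda>k. om k y) (\<lambda>k. eta k y) = 0"
  by (simp add: om_def pair_linear pair_x_eta pair_eta_eta)

lemma pair_x_om: "pair (\<lambda>k. x $ k) (\<lambda>k. om k y) = R (s y)"
  by (simp add: om_def pair_linear pair_x_eta pair_x_x R_def power2_eq_square)

lemma pair_om_om: "pair (\<lambda>k. om k y) (\<lambda>k. om k y) = R (s y)"
  by (subst (2) om_def)
     (simp add: pair_linear pair_om_eta pair_commute[of "\<lambda>k. om k y" "\<lambda>k. x $ k"] pair_x_om)

lemma pair_eta_om: "pair (\<lambda>k. eta k y) (\<lambda>k. om k y) = 0"
  using pair_om_eta pair_commute by metis

lemma pair_p_eta: "pair (\<lambda>k. p i k y) (\<lambda>k. eta k y) = 0" "pair (\<lambda>k. eta k y) (\<lambda>k. p i k y) = 0"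
  using pair_commute[of "\<lambda>k. eta k y"] by (simp_all add: pair_p pair_eta_eta pair_om_eta)

lemma pair_p_om: "pair (\<lambda>k. p i k y) (\<lambda>k. om k y) = 0" "pair (\<lambda>k. om k y) (\<lambda>k. p i k y) = 0"
  using pair_commute[of "\<lambda>k. om k y"] nonzero[OF y] by (simp_all add: pair_p pair_eta_om pair_om_om)

lemma pair_p_p: "pair (\<lambda>k. p i k y) (\<lambda>k. p j k y) = p i j y"
  by (subst pair_p) (simp add: pair_p_eta pair_p_om p_commute[of j i])

lemmas contractions = pair_eta_eta pair_om_eta pair_eta_om pair_om_om pair_p_eta pair_p_om pair_p_p

lemma g_eq_p:
  "g i j y = lam i y * lam j y + G (s y) * p i j y + f0 (s y) * Del (s y) / R (s y) * om i y * om j y"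
  using nonzero[OF y] by (simp add: g_def p_def Del_def G_def field_simps)

lemma g_mult_g_inv: "pair (\<lambda>k. g i k y) (\<lambda>k. g_inv j k y) = kron i j"
proof -
  \<comment> \<open>The identity split into the orthogonal projections onto y, onto omega and onto
    their complement, matching the blocks of the metric.\<close>
  have k: "kron i j = p i j y + eta i y * eta j y + om i y * om j y / R (s y)"
    by (simp add: p_def h_def)
  show ?thesis
    unfolding g_eq_p g_inv_def lam_def om_tilde_def k
    using nonzero[OF y] by (simp add: pair_linear contractions) (simp add: field_simps power2_eq_square)
qed

lemma g_inv_commute: "g_inv i j y = g_inv j i y"
  by (simp add: g_inv_def p_commute mult.commute)

lemma inv_fund_eq: "inv_fund_tensor F x y $ i $ j = g_inv i j y"
proof -
  have "fund_tensor F x y ** (\<chi> i j. g_inv i j y) = mat 1"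
    by (simp add: vec_eq_iff matrix_matrix_mult_def mat_def fund_eq[OF y] kron_def[symmetric]
        g_mult_g_inv[unfolded pair_def, symmetric] g_inv_commute[of _ "_ :: 'n"])
  then show ?thesis unfolding inv_fund_tensor_def
    by (subst matrix_inv_eqI) auto
qed

text \<open>Replacing \<open>h\<close> by \<open>p\<close> moves 3 G1 / R into the coefficient of
  the omega cube, which becomes \<open>M\<close>. No \<open>eta\<close> occurs, so the
  \<open>eta\<close> block of \<open>g_inv\<close> drops out of all contractions with
  \<open>c\<close>.\<close>

lemma c_eq_p: "c i j k y = G1 (s y) * (om i y * p j k y + om j y * p i k y + om k y * p i j y)
     + M (s y) * om i y * om j y * om k y"
  using nonzero[OF y] by (simp add: c_def p_def M_def field_simps)

lemma cartan_up_eq: "cartan_up F x y r i j =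
   (om_tilde r y / (f0 (s y) * Del (s y)) * (G1 (s y) * p i j y + M (s y) * om i y * om j y)
     + G1 (s y) / G (s y) * (p i r y * om j y + p j r y * om i y)) / (2 * norm y)"
proof -
  have "cartan_up F x y r i j = pair (\<lambda>k. g_inv r k y) (\<lambda>k. c i j k y / (2 * norm y))"
    by (simp add: cartan_up_def inv_fund_eq cartan_eq[OF y] pair_def c_def h_commute mult_ac add_ac)
  also have "\<dots> = pair (\<lambda>k. g_inv r k y) (\<lambda>k. c i j k y) / (2 * norm y)"
    by (simp add: pair_linear)
  also have "pair (\<lambda>k. g_inv r k y) (\<lambda>k. c i j k y) = 
     om_tilde r y / (f0 (s y) * Del (s y)) * (G1 (s y) * p i j y + M (s y) * om i y * om j y)
     + G1 (s y) / G (s y) * (p i r y * om j y + p j r y * om i y)"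
    unfolding c_eq_p g_inv_def om_tilde_def
    using nonzero[OF y] by (simp add: pair_linear contractions) 
      (simp add: field_simps power2_eq_square p_commute[of r])
  finally show ?thesis .
qed

text \<open>The contraction of two Cartan tensors up to scaling. The two summands come from the
  \<open>om_tilde\<close> and the \<open>p\<close> block of \<open>g_inv\<close>; mixed terms
  vanish.\<close>

definition cartan_sq :: "'n \<Rightarrow> 'n \<Rightarrow> 'n \<Rightarrow> 'n \<Rightarrow> real" where
  "cartan_sq l k i j = R (s y) / (f0 (s y) * Del (s y)) * (G1 (s y) * p l k y + M (s y) * om l y * om k y)
      * (G1 (s y) * p i j y + M (s y) * om i y * om j y)
    + (G1 (s y))\<^sup>2 / G (s y) * (p l i y * om k y * om j y + p l j y * om k y * om i y
       + p k i y * om l y * om j y + p k j y * om l y * om i y)"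

lemma cartan_cartan: "(\<Sum>r\<in>UNIV. cartan_up F x y r l k * c i j r y) = cartan_sq l k i j / (2 * norm y)"
proof -
  have "(\<Sum>r\<in>UNIV. cartan_up F x y r l k * c i j r y) = pair (\<lambda>r. cartan_up F x y r l k) (\<lambda>r. c i j r y)"
    by (simp add: pair_def)
  also have "\<dots> = cartan_sq l k i j / (2 * norm y)"
    unfolding cartan_up_eq c_eq_p om_tilde_def cartan_sq_def
    using nonzero[OF y] by (simp add: pair_linear contractions) (simp add: field_simps power2_eq_square)
  finally show ?thesis .
qed

end

section \<open>The derivative of the Cartan tensor and the T-tensor\<close>

lemma has_partial_c: assumes "y \<in> Y" shows "has_partial (c i j k) l
  ((- s y * K (s y) * om l y * (om i y * h j k y + om j y * h i k y + om k y * h i j y)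
    + G1 (s y) * (- (om l y * eta i y + s y * h i l y) * h j k y - om i y * (h j l y * eta k y + eta j y * h k l y)
       - (om l y * eta j y + s y * h j l y) * h i k y - om j y * (h i l y * eta k y + eta i y * h k l y)
       - (om l y * eta k y + s y * h k l y) * h i j y - om k y * (h i l y * eta j y + eta i y * h j l y))
    + K1 (s y) * om i y * om j y * om k y * om l y
    - K (s y) * ((om l y * eta i y + s y * h i l y) * om j y * om k y
       + (om l y * eta j y + s y * h j l y) * om i y * om k y
       + (om l y * eta k y + s y * h k l y) * om i y * om j y)) / norm y) y"
  unfolding c_def[abs_def]
  apply (rule has_partial_eq, (rule has_partial_intros assms)+)
  using Y_D[OF assms] apply (simp add: divide_simps)
  apply (simp add: algebra_simps)
  done

text \<open>The derivative of the Cartan tensor up to scaling, sorted by products of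
  \<open>om\<close> and \<open>p\<close>. The \<open>eta\<close> terms on the last line are the ones
  that the \<open>ell\<close> terms of the T-tensor cancel.\<close>

definition dcartan :: "'n \<Rightarrow> 'n \<Rightarrow> 'n \<Rightarrow> 'n \<Rightarrow> real^'n \<Rightarrow> real" where
  "dcartan i j k l y =
     (- s y * K (s y) - s y * G1 (s y) / R (s y)) *
       (om i y * om j y * p k l y + om i y * om k y * p j l y + om i y * om l y * p j k y
        + om j y * om k y * p i l y + om j y * om l y * p i k y + om k y * om l y * p i j y)
     + (K1 (s y) - 6 * s y * K (s y) / R (s y) - 3 * s y * G1 (s y) / (R (s y))\<^sup>2) *
       (om i y * om j y * om k y * om l y)
     - s y * G1 (s y) * (p i j y * p k l y + p i k y * p j l y + p i l y * p j k y)
     - (eta i y * c j k l y + eta j y * c i k l y + eta k y * c i j l y + eta l y * c i j k y)"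

lemma partial_cartan: assumes y: "y \<in> Y"
  shows "partial l (\<lambda>z. cartan F x z i j k) y = dcartan i j k l y / (2 * (norm y)\<^sup>2)"
proof -
  have hp: "h a b y = p a b y + om a y * om b y / R (s y)" for a b
    by (simp add: p_def)
  note nonzero = nonzero[OF y]
  have "has_partial (\<lambda>z. c i j k z / (2 * norm z)) l (dcartan i j k l y / (2 * (norm y)\<^sup>2)) y"
    apply (rule has_partial_eq, (rule has_partial_divide has_partial_c has_partial_intros y)+)
    using nonzero apply simp
    apply (simp add: dcartan_def c_def hp p_commute[of l] p_commute[of k j] p_commute[of k i] p_commute[of j i])
    apply (simp add: divide_simps)
    apply (simp add: algebra_simps power2_eq_square)
    done
  then have "has_partial (\<lambda>z. cartan F x z i j k) l (dcartan i j k l y / (2 * (norm y)\<^sup>2)) y"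
    by (rule has_partial_transform[OF _ open_Y y]) (simp add: cartan_eq)
  then show ?thesis by (rule partial_eqI)
qed

definition T_red :: "'n \<Rightarrow> 'n \<Rightarrow> 'n \<Rightarrow> 'n \<Rightarrow> real^'n \<Rightarrow> real" where
  "T_red i j k l y = A4 (s y) * (om i y * om j y * om k y * om l y)
     + B4 (s y) * (om i y * om j y * p k l y + om i y * om k y * p j l y + om i y * om l y * p j k y
        + om j y * om k y * p i l y + om j y * om l y * p i k y + om k y * om l y * p i j y)
     + C4 (s y) * (p i j y * p k l y + p i k y * p j l y + p i l y * p j k y)"

lemma c_commute: "c i j k z = c j i k z" "c i j k z = c i k j z"
  by (simp_all add: c_def h_commute[of j i] h_commute[of k j] algebra_simps)

lemma T_eq: assumes y: "y \<in> Y"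
  shows "T_tensor F x y i j k l = f0 (s y) / (2 * norm y) * T_red i j k l y"
proof -
  note nonzero = nonzero[OF y]
  have cart: "cartan F x y i j k = c i j k y / (2 * norm y)" for i j k
    using cartan_eq[OF y] .
  have cyc: "c r i j y = c i j r y" for r i j
    by (metis c_commute)
  have C1: "(\<Sum>r\<in>UNIV. cartan_up F x y r l k * cartan F x y r i j) = cartan_sq y l k i j / (2 * norm y)\<^sup>2" for l k i j
    using cartan_cartan[OF y, of l k i j] nonzero
    by (simp add: cart cyc[of _ i j] sum_divide_distrib[symmetric] power2_eq_square)
  have C2: "(\<Sum>r\<in>UNIV. cartan_up F x y r l k * cartan F x y i r j) = cartan_sq y l k i j / (2 * norm y)\<^sup>2" for l k i j
    using C1[of l k i j] by (simp add: cart c_commute(1)[of i])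
  have C3: "(\<Sum>r\<in>UNIV. cartan_up F x y r l k * cartan F x y i j r) = cartan_sq y l k i j / (2 * norm y)\<^sup>2" for l k i j
    using C2[of l k i j] by (simp add: cart c_commute(2)[of i j])
  have ff: "F x y = norm y * f0 (s y)" by (simp add: F s_def)
  have "T_tensor F x y i j k l = norm y * f0 (s y) * (dcartan i j k l y / (2 * (norm y)\<^sup>2)
      - cartan_sq y i l j k / (2 * norm y)\<^sup>2 - cartan_sq y j l i k / (2 * norm y)\<^sup>2 - cartan_sq y k l i j / (2 * norm y)\<^sup>2)
     + (c i j k y * lam l y + c i j l y * lam k y + c i k l y * lam j y + c j k l y * lam i y) / (2 * norm y)"
    unfolding T_tensor_def C1 C2 C3
    unfolding partial_cartan[OF y] cart ff ell_eq[OF y]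
    by (simp add: add_divide_distrib)
  also have "\<dots> = f0 (s y) / (2 * norm y) * (dcartan i j k l y - cartan_sq y i l j k / 2 - cartan_sq y j l i k / 2 - cartan_sq y k l i j / 2
     + (c i j k y * lam l y + c i j l y * lam k y + c i k l y * lam j y + c j k l y * lam i y) / f0 (s y))"
    using nonzero by (simp add: field_simps power2_eq_square)
  also have "dcartan i j k l y - cartan_sq y i l j k / 2 - cartan_sq y j l i k / 2 - cartan_sq y k l i j / 2
     + (c i j k y * lam l y + c i j l y * lam k y + c i k l y * lam j y + c j k l y * lam i y) / f0 (s y)
     = T_red i j k l y"
  proof -
    \<comment> \<open>With the quotients named, the claim is a polynomial identity in the remaining
      symbols.\<close>
    define a where "a = R (s y) / (2 * (f0 (s y) * Del (s y)))"
    define b where "b = (G1 (s y))\<^sup>2 / (2 * G (s y))"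
    define d where "d = f1 (s y) / f0 (s y)"
    \<comment> \<open>The \<open>eta\<close> part cancels the last line of \<open>dcartan\<close>;
      the \<open>om\<close> part yields the terms with f1 / f0 in \<open>A4\<close> and
      \<open>B4\<close>.\<close>
    have cl: "c i j k y * lam l y / f0 (s y) = c i j k y * (eta l y + d * om l y)" for i j k l
      using nonzero by (simp add: lam_def d_def field_simps)
    have A: "A4 (s y) = K1 (s y) - 6 * s y * K (s y) / R (s y) - 3 * s y * G1 (s y) / (R (s y))\<^sup>2
       - 3 * (a * (M (s y))\<^sup>2) + 4 * (M (s y) * d)"
      "B4 (s y) = - s y * K (s y) - s y * G1 (s y) / R (s y) - a * (M (s y) * G1 (s y)) - 2 * b + 2 * (G1 (s y) * d)"
      "C4 (s y) = - s y * G1 (s y) - a * (G1 (s y))\<^sup>2"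
      unfolding A4_def B4_def C4_def a_def b_def d_def by (simp_all add: field_simps)
    have cartan_sq: "cartan_sq y l k i j / 2 = a * (G1 (s y) * p l k y + M (s y) * om l y * om k y)
      * (G1 (s y) * p i j y + M (s y) * om i y * om j y)
       + b * (p l i y * om k y * om j y + p l j y * om k y * om i y
       + p k i y * om l y * om j y + p k j y * om l y * om i y)" for l k i j
      unfolding cartan_sq_def[OF y] a_def b_def add_divide_distrib by simp
    show ?thesis
      unfolding add_divide_distrib cl
      unfolding dcartan_def T_red_def A cartan_sq c_eq_p[OF y]
      by (simp only: p_commute[of l] p_commute[of k j] p_commute[of k i] p_commute[of j i])
         (simp add: algebra_simps power2_eq_square)
  qed
  finally show ?thesis .
qed

lemma T_red_commute: "T_red i j k l y = T_red j i k l y" "T_red i j k l y = T_red i k j l y" "T_red i j k l y = T_red i j l k y"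
  by (simp_all add: T_red_def p_commute[of j i] p_commute[of k j] p_commute[of l k] algebra_simps)

section \<open>The T-tensor contracted with a covector\<close>

definition proj :: "('n \<Rightarrow> real) \<Rightarrow> 'n \<Rightarrow> real^'n \<Rightarrow> real" where
  "proj v i y = pair (\<lambda>k. p i k y) v"

text \<open>T annihilates y, so of the raised covector only the \<open>om_tilde\<close> and
  \<open>p\<close> components contribute.\<close>

lemma contracted_T_eq:
  assumes y: "y \<in> Y"
  shows "(\<Sum>a\<in>UNIV. v a * T_tensor_up F x y a i j k) = f0 (s y) / (2 * norm y) *
     (pair (\<lambda>k. om_tilde k y) v / (f0 (s y) * Del (s y)) *
        (A4 (s y) * (om i y * om j y * om k y)
         + B4 (s y) * (om i y * p j k y + om j y * p i k y + om k y * p i j y))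
      + (B4 (s y) * (om i y * om j y * proj v k y + om i y * om k y * proj v j y + om j y * om k y * proj v i y)
         + C4 (s y) * (p i j y * proj v k y + p i k y * proj v j y + p j k y * proj v i y)) / G (s y))"
proof -
  note nonzero = nonzero[OF y]
  define V where "V b = pair (\<lambda>a. g_inv a b y) v" for b
  have "(\<Sum>a\<in>UNIV. v a * T_tensor_up F x y a i j k)
      = (\<Sum>a\<in>UNIV. \<Sum>b\<in>UNIV. v a * (g_inv a b y * T_tensor F x y b i j k))"
    by (simp add: T_tensor_up_def inv_fund_eq[OF y] sum_distrib_left)
  also have "\<dots> = pair V (\<lambda>b. T_tensor F x y b i j k)"
    by (subst sum.swap) (simp add: V_def pair_def sum_distrib_left mult_ac)
  also have "\<dots> = f0 (s y) / (2 * norm y) * pair V (\<lambda>b. T_red i j k b y)"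
    unfolding T_eq[OF y] using T_red_commute by (simp add: pair_linear T_red_commute)
  finally have 1: "(\<Sum>a\<in>UNIV. v a * T_tensor_up F x y a i j k) = f0 (s y) / (2 * norm y) * pair V (\<lambda>b. T_red i j k b y)" .
  have V: "V b = eta b y * pair (\<lambda>a. eta a y) v / (f0 (s y))\<^sup>2
     + om_tilde b y * pair (\<lambda>a. om_tilde a y) v / (f0 (s y) * Del (s y) * R (s y)) + proj v b y / G (s y)" for b
    unfolding V_def g_inv_def proj_def p_commute[of _ b] by (simp add: pair_linear mult.commute)
  have po: "pair (\<lambda>b. proj v b y) (\<lambda>k. om k y) = 0"
  proof -
    have "pair (\<lambda>b. proj v b y) (\<lambda>k. om k y) = pair v (\<lambda>k. pair (\<lambda>b. p k b y) (\<lambda>b. om b y))"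
      unfolding proj_def pair_def sum_distrib_right sum_distrib_left
      by (subst sum.swap) (simp add: p_commute mult_ac)
    then show ?thesis by (simp add: contractions[OF y]) (simp add: pair_def)
  qed
  have pp: "pair (\<lambda>b. proj v b y) (\<lambda>k. p i k y) = proj v i y" for i
  proof -
    have "pair (\<lambda>b. proj v b y) (\<lambda>k. p i k y) = pair v (\<lambda>k. pair (\<lambda>b. p k b y) (\<lambda>b. p i b y))"
      unfolding proj_def pair_def sum_distrib_right sum_distrib_left
      by (subst sum.swap) (simp add: p_commute mult_ac)
    then show ?thesis by (simp add: contractions[OF y] proj_def pair_commute[of v] p_commute[of _ i])
  qed
  have oo: "pair (\<lambda>b. om_tilde b y) (\<lambda>b. om b y) = R (s y)" "pair (\<lambda>b. om_tilde b y) (\<lambda>b. p i b y) = 0" for i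
    unfolding om_tilde_def by (simp_all add: pair_linear contractions[OF y])
  have "pair V (\<lambda>b. T_red i j k b y) = pair (\<lambda>k. om_tilde k y) v / (f0 (s y) * Del (s y)) *
        (A4 (s y) * (om i y * om j y * om k y)
         + B4 (s y) * (om i y * p j k y + om j y * p i k y + om k y * p i j y))
      + (B4 (s y) * (om i y * om j y * proj v k y + om i y * om k y * proj v j y + om j y * om k y * proj v i y)
         + C4 (s y) * (p i j y * proj v k y + p i k y * proj v j y + p j k y * proj v i y)) / G (s y)"
    unfolding V T_red_def using nonzero
    by (simp add: pair_linear contractions[OF y] po pp oo) (simp add: field_simps)
  then show ?thesis unfolding 1 by simp
qed

text \<open>Contracting with omega removes \<open>C4\<close>, and contracting then with z removes
  \<open>A4\<close>, because \<open>p\<close> kills omega and omega is orthogonal to z. The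
  remaining vector \<open>Z1\<close> shows B4 times t along omega and B4 times a nonzero multiple of
  q along z, so either part of v suffices.\<close>

lemma B4_eq_0:
  assumes y: "y \<in> Y" and T: "\<And>i j k. (\<Sum>a\<in>UNIV. v $ a * T_tensor_up F x y a i j k) = 0"
    and z: "x \<bullet> z = 0" "y \<bullet> z = 0" "z \<noteq> 0"
    and v: "v = q *\<^sub>R x + t *\<^sub>R z" "q \<noteq> 0 \<and> t = 0 \<or> t = 1"
  shows "B4 (s y) = 0"
proof -
  note nonzero = nonzero[OF y]
  have xz: "pair (\<lambda>k. x $ k) (\<lambda>k. z $ k) = 0"
    using z(1) by (simp add: pair_def inner_vec_def)
  have ez: "pair (\<lambda>k. eta k y) (\<lambda>k. z $ k) = 0"
    using z(2) by (simp add: pair_def eta_def inner_vec_def sum_divide_distrib[symmetric])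
  have oz: "pair (\<lambda>k. om k y) (\<lambda>k. z $ k) = 0"
    by (simp add: om_def pair_linear xz ez)
  have zz: "pair (\<lambda>k. z $ k) (\<lambda>k. z $ k) \<noteq> 0"
    using z(3) by (simp add: pair_def inner_vec_def[symmetric, where 'a=real, simplified])
  have comm: "pair (\<lambda>k. z $ k) (\<lambda>k. om k y) = pair (\<lambda>k. om k y) (\<lambda>k. z $ k)"
    "pair (\<lambda>k. z $ k) (\<lambda>k. p i k y) = pair (\<lambda>k. p i k y) (\<lambda>k. z $ k)" for i
    by (rule pair_commute)+
  have pz: "pair (\<lambda>k. p i k y) (\<lambda>k. z $ k) = z $ i" for i
    by (simp add: pair_p ez oz)
  have px: "pair (\<lambda>k. p i k y) (\<lambda>k. x $ k) = 0" for i
    using nonzero by (simp add: pair_p pair_commute[of _ "\<lambda>k. x $ k"] pair_x_eta pair_x_om[OF y] om_def[of i])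
  have proj: "proj (\<lambda>k. v $ k) i y = t * z $ i" for i
    by (simp add: proj_def v(1) pair_linear px pz)
  define \<kappa> where "\<kappa> = pair (\<lambda>k. om_tilde k y) (\<lambda>k. v $ k) / (f0 (s y) * Del (s y))"
  have "pair (\<lambda>k. om_tilde k y) (\<lambda>k. x $ k) = R (s y) * (f0 (s y) - s y * f1 (s y)) / f0 (s y)"
    using nonzero by (simp add: om_tilde_def pair_linear pair_commute[of _ "\<lambda>k. x $ k"] pair_x_eta pair_x_om[OF y] field_simps)
  moreover have "pair (\<lambda>k. om_tilde k y) (\<lambda>k. z $ k) = 0"
    by (simp add: om_tilde_def pair_linear ez oz)
  ultimately have \<kappa>: "\<kappa> = q * (R (s y) * (f0 (s y) - s y * f1 (s y)) / f0 (s y)) / (f0 (s y) * Del (s y))"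
    by (simp add: \<kappa>_def v(1) pair_linear)
  \<comment> \<open>The index i is put last in each \<open>p\<close>, so that contraction over i
    matches \<open>pair_p_om\<close>.\<close>
  define Z where "Z i j k = \<kappa> * (A4 (s y) * (om i y * om j y * om k y)
         + B4 (s y) * (om i y * p j k y + om j y * p k i y + om k y * p j i y))
      + (B4 (s y) * (om i y * om j y * (t * z $ k) + om i y * om k y * (t * z $ j) + om j y * om k y * (t * z $ i))
         + C4 (s y) * (p j i y * (t * z $ k) + p k i y * (t * z $ j) + p j k y * (t * z $ i))) / G (s y)"
    for i j k
  have Z_0: "Z i j k = 0" for i j k
    using T[of i j k] nonzero f0_pos[OF Y_D(4)[OF y]]
    unfolding contracted_T_eq[OF y] proj \<kappa>_def[symmetric] Z_def by (simp add: p_commute)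
  define Z2 where "Z2 j k = \<kappa> * (A4 (s y) * (om j y * om k y) + B4 (s y) * p j k y)
      + B4 (s y) * t * (om j y * z $ k + om k y * z $ j) / G (s y)" for j k
  have "pair (\<lambda>i. om i y) (\<lambda>i. Z i j k) = R (s y) * Z2 j k" for j k
    unfolding Z_def Z2_def
    by (simp add: pair_linear contractions[OF y] oz) (simp add: algebra_simps add_divide_distrib)
  then have Z2_0: "Z2 j k = 0" for j k
    using nonzero by (simp add: Z_0 pair_def)
  define Z1 where "Z1 j = \<kappa> * B4 (s y) * z $ j
      + B4 (s y) * t * om j y * pair (\<lambda>k. z $ k) (\<lambda>k. z $ k) / G (s y)" for j
  have "pair (\<lambda>k. z $ k) (\<lambda>k. Z2 j k) = Z1 j" for j
    unfolding Z1_def Z2_def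
    by (simp add: pair_linear comm oz pz)
  then have Z1_0: "Z1 j = 0" for j
    by (simp add: Z2_0 pair_def)
  have "pair (\<lambda>k. om k y) Z1 = B4 (s y) * t * R (s y) * pair (\<lambda>k. z $ k) (\<lambda>k. z $ k) / G (s y)"
    unfolding Z1_def[abs_def] by (simp add: pair_linear contractions[OF y] oz)
  then have 2: "B4 (s y) * t = 0" using nonzero zz by (simp add: pair_def Z1_0)
  have "pair (\<lambda>k. z $ k) Z1 = \<kappa> * B4 (s y) * pair (\<lambda>k. z $ k) (\<lambda>k. z $ k)"
    unfolding Z1_def[abs_def] by (simp add: pair_linear comm oz)
  then have 3: "\<kappa> * B4 (s y) = 0" using zz by (simp add: pair_def Z1_0)
  show ?thesis
  proof (cases "t = 0")
    case True
    then have "\<kappa> \<noteq> 0" using v(2) nonzero nondeg(1)[OF Y_D(4)[OF y]] by (simp add: \<kappa>)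
    then show ?thesis using 3 by simp
  qed (use 2 in simp)
qed

text \<open>x is a combination of y and omega, so its \<open>p\<close> projection vanishes and no
  \<open>C4\<close> term is left.\<close>

lemma contracted_T_eq_0:
  assumes y: "y \<in> Y" and "A4 (s y) = 0" "B4 (s y) = 0"
  shows "(\<Sum>a\<in>UNIV. q * x $ a * T_tensor_up F x y a i j k) = 0"
proof -
  have px: "pair (\<lambda>k. p i k y) (\<lambda>k. x $ k) = 0" for i
    using nonzero[OF y] by (simp add: pair_p pair_commute[of _ "\<lambda>k. x $ k"] pair_x_eta pair_x_om[OF y] om_def[of i])
  then have proj: "proj (\<lambda>k. q * x $ k) i y = 0" for i
    by (simp add: proj_def pair_linear)
  show ?thesis using assms by (simp add: contracted_T_eq proj)
qed

lemma T_tensor_eq_0: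
  assumes "y \<in> Y" "A4 (s y) = 0" "B4 (s y) = 0" "C4 (s y) = 0"
  shows "T_tensor F x y i j k l = 0"
  using assms by (simp add: T_eq T_red_def)

end

section \<open>Both conditions on the whole domain\<close>

text \<open>Iterated s-derivatives taken as directional derivatives in the plane, which keeps them
  jointly smooth in (r, s); \<open>jet_deriv\<close> returns to derivatives along a slice.\<close>

definition jet :: "(real \<Rightarrow> real \<Rightarrow> real) \<Rightarrow> nat \<Rightarrow> real \<times> real \<Rightarrow> real" where
  "jet \<phi> k = ((\<lambda>f q. frechet_derivative f (at q) (0, 1)) ^^ k) (\<lambda>(r, s). \<phi> r s)"

locale spherical_data =
  fixes D :: "(real \<times> real) set" and \<phi> :: "real \<Rightarrow> real \<Rightarrow> real"
  assumes sph: "sph_finsler D \<phi>"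
begin

abbreviation J :: "nat \<Rightarrow> real \<Rightarrow> real \<Rightarrow> real" where "J k r s \<equiv> jet \<phi> k (r, s)"

lemma D_props: "open D" "connected D" "D \<noteq> {}" "(r, s) \<in> D \<Longrightarrow> r > 0" "(r, s) \<in> D \<Longrightarrow> \<bar>s\<bar> < r"
  "is_interval {s. (r, s) \<in> D}" "(r, s) \<in> D \<Longrightarrow> \<phi> r s > 0"
  using sph by (auto simp: sph_finsler_def)

lemma open_slices: "open {s. (r, s) \<in> D}" "open {r. (r, s) \<in> D}"
proof -
  have "open (Pair r -` D)" "open ((\<lambda>r. (r, s)) -` D)"
    by (rule open_vimage[OF D_props(1)], intro continuous_intros)+
  then show "open {s. (r, s) \<in> D}" "open {r. (r, s) \<in> D}" by (simp_all add: vimage_def)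
qed

lemma smooth_jet: "smooth_on D (jet \<phi> k)"
proof (induction k)
  case 0
  then show ?case using sph by (simp add: jet_def sph_finsler_def)
next
  case (Suc k)
  then show ?case using smooth_on_derivative[of D "jet \<phi> k" "(0, 1)"] by (simp add: jet_def)
qed

lemma jet_deriv:
  assumes "(r, s) \<in> D" shows "(J k r has_real_derivative J (Suc k) r s) (at s)"
proof -
  have "Ck_on (Suc 0) D (jet \<phi> k)" using smooth_jet unfolding smooth_on_def by blast
  then have "(jet \<phi> k has_derivative frechet_derivative (jet \<phi> k) (at (r, s))) (at (r, s))"
    using assms by (rule Ck_on_has_derivative)
  then have d: "((\<lambda>t. jet \<phi> k (r, t)) has_derivative (\<lambda>v. frechet_derivative (jet \<phi> k) (at (r, s)) (0, v))) (at s)"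
    by (rule has_derivative_compose[of "\<lambda>t. (r, t)" "\<lambda>v. (0, v)", rotated]) (auto intro!: derivative_eq_intros)
  define c where "c = frechet_derivative (jet \<phi> k) (at (r, s)) (0, 1)"
  have "frechet_derivative (jet \<phi> k) (at (r, s)) (0, v) = c * v" for v
  proof -
    have "linear (\<lambda>v. frechet_derivative (jet \<phi> k) (at (r, s)) (0, v))"
      using d has_derivative_linear by blast
    from linear_cmul[OF this, of v 1] show ?thesis by (simp add: c_def)
  qed
  then have "((\<lambda>t. jet \<phi> k (r, t)) has_real_derivative c) (at s)"
    using d by (simp add: has_field_derivative_def)
  then show ?thesis by (simp add: c_def jet_def)
qed

lemma J0: "J 0 r s = \<phi> r s" by (simp add: jet_def)

lemma deriv_phi: assumes "(r, s) \<in> D" shows "deriv (\<phi> r) s = J (Suc 0) r s" "deriv (deriv (\<phi> r)) s = J 2 r s"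
proof -
  have 1: "deriv (\<phi> r) s = J (Suc 0) r s" if "(r, s) \<in> D" for s
    using jet_deriv[OF that, of 0] by (simp add: J0 DERIV_imp_deriv)
  then show "deriv (\<phi> r) s = J (Suc 0) r s" using assms .
  have "(J (Suc 0) r has_real_derivative J 2 r s) (at s)"
    using jet_deriv[OF assms, of 1] by (simp add: numeral_2_eq_2)
  then have "(deriv (\<phi> r) has_real_derivative J 2 r s) (at s)"
    by (rule has_field_derivative_transform_within_open[OF _ open_slices(1)[of r]])
       (use assms 1 in auto)
  then show "deriv (deriv (\<phi> r)) s = J 2 r s" by (rule DERIV_imp_deriv)
qed

text \<open>With r left as a parameter, \<open>j.psi\<close>, \<open>j.E1\<close> and the like
  become functions of (r, s). For an empty slice the assumptions hold vacuously.\<close>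

sublocale j: radial_jet r "{s. (r, s) \<in> D}" "J 0 r" "J (Suc 0) r" "J 2 r" "J 3 r" "J 4 r" for r
proof
  show "open {s. (r, s) \<in> D}" by (rule open_slices)
  fix s assume "s \<in> {s. (r, s) \<in> D}"
  then have rs: "(r, s) \<in> D" by simp
  show "\<bar>s\<bar> < r" "J 0 r s > 0" using D_props rs by (auto simp: J0)
  show "(J 0 r has_real_derivative J (Suc 0) r s) (at s)" "(J (Suc 0) r has_real_derivative J 2 r s) (at s)"
    "(J 2 r has_real_derivative J 3 r s) (at s)" "(J 3 r has_real_derivative J 4 r s) (at s)"
    using jet_deriv[OF rs, of 0] jet_deriv[OF rs, of "Suc 0"] jet_deriv[OF rs, of 2] jet_deriv[OF rs, of 3]
    by (simp_all add: numeral_eq_Suc)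
  show "J 0 r s - s * J (Suc 0) r s \<noteq> 0" "J 0 r s - s * J (Suc 0) r s + (r\<^sup>2 - s\<^sup>2) * J 2 r s \<noteq> 0"
    using sph rs by (auto simp: sph_finsler_def J0 deriv_phi[OF rs, symmetric])
qed

definition smooth2 :: "(real \<Rightarrow> real \<Rightarrow> real) \<Rightarrow> bool" where
  "smooth2 f \<longleftrightarrow> smooth_on D (\<lambda>q. f (fst q) (snd q))"

lemma smooth2_intros:
  "smooth2 (\<lambda>r s. c)" "smooth2 (\<lambda>r s. r)" "smooth2 (\<lambda>r s. s)" "smooth2 (J k)"
  "smooth2 f \<Longrightarrow> smooth2 g \<Longrightarrow> smooth2 (\<lambda>r s. f r s + g r s)"
  "smooth2 f \<Longrightarrow> smooth2 g \<Longrightarrow> smooth2 (\<lambda>r s. f r s - g r s)"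
  "smooth2 f \<Longrightarrow> smooth2 g \<Longrightarrow> smooth2 (\<lambda>r s. f r s * g r s)"
  "smooth2 f \<Longrightarrow> smooth2 (\<lambda>r s. f r s ^ n)"
  "smooth2 f \<Longrightarrow> smooth2 g \<Longrightarrow> (\<And>r s. (r, s) \<in> D \<Longrightarrow> g r s \<noteq> 0) \<Longrightarrow> smooth2 (\<lambda>r s. f r s / g r s)"
  "smooth2 f \<Longrightarrow> (\<And>r s. (r, s) \<in> D \<Longrightarrow> f r s > 0) \<Longrightarrow> smooth2 (\<lambda>r s. sqrt (f r s))"
  unfolding smooth2_def using D_props(1) smooth_jet[of k]
  by (auto intro!: smooth_on_const smooth_on_linear[OF _ bounded_linear_fst] smooth_on_linear[OF _ bounded_linear_snd] smooth_on_add smooth_on_diff smooth_on_mult smooth_on_power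
      smooth_on_divide smooth_on_sqrt)

lemma smooth2_scalars: "smooth2 j.R" "smooth2 j.D1" "smooth2 j.K" "smooth2 j.psi" "smooth2 j.psi1" "smooth2 j.e" "smooth2 j.w" "smooth2 j.N" "smooth2 j.psi2"
  "smooth2 j.E1" "smooth2 j.E1'" "smooth2 j.E2"
proof -
  have J: "smooth2 (\<lambda>r s. J k r s)" for k by (rule smooth2_intros)
  show R: "smooth2 j.R" unfolding j.R_def[abs_def] by (intro smooth2_intros)
  show D1: "smooth2 j.D1" unfolding j.D1_def[abs_def] by (intro smooth2_intros)
  show K: "smooth2 j.K" unfolding j.K_def[abs_def] by (intro smooth2_intros)
  show psi: "smooth2 j.psi" unfolding j.psi_def[abs_def] by (intro smooth2_intros D1) (rule j.D1_nz, simp)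
  show psi1: "smooth2 j.psi1" unfolding j.psi1_def[abs_def] by (intro smooth2_intros D1) (rule power_not_zero, rule j.D1_nz, simp)
  show e: "smooth2 j.e" unfolding j.e_def[abs_def] by (intro smooth2_intros psi psi1)
  show w: "smooth2 j.w" unfolding j.w_def[abs_def] by (intro smooth2_intros psi)
  show N: "smooth2 j.N" unfolding j.N_def[abs_def] by (intro smooth2_intros w R psi1)
  show psi2: "smooth2 j.psi2" unfolding j.psi2_def[abs_def]
    by (intro smooth2_intros K D1 psi1 e w) (rule power_not_zero j.D1_nz j.w_nz | simp)+
  show "smooth2 j.E1" "smooth2 j.E1'" "smooth2 j.E2"
    unfolding j.E1_def[abs_def] j.E1'_def[abs_def] j.E2_def[abs_def] by (intro smooth2_intros N R e psi2)+
qed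

lemma smooth2_continuous: "smooth2 f \<Longrightarrow> continuous_on D (\<lambda>q. f (fst q) (snd q))"
  unfolding smooth2_def by (rule smooth_on_continuous)

section \<open>The dichotomy on the connected domain\<close>

lemma E1_or_E2:
  assumes B4: "\<And>r s. (r, s) \<in> D \<Longrightarrow> j.B4 r s = 0"
  shows "(\<forall>(r, s)\<in>D. j.E1 r s = 0) \<or> (\<forall>(r, s)\<in>D. j.E2 r s = 0)"
proof -
  \<comment> \<open>Without \<open>E1'\<close> the two sets could meet: for phi = 1 both
    \<open>E1\<close> and \<open>E2\<close> vanish at s = 0.\<close>
  define Z1 where "Z1 = {q \<in> D. j.E1 (fst q) (snd q) = 0} \<inter> {q \<in> D. j.E1' (fst q) (snd q) = 0}"
  define Z2 where "Z2 = {q \<in> D. j.E2 (fst q) (snd q) = 0}"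
  have cl: "closedin (top_of_set D) Z1" "closedin (top_of_set D) Z2"
    unfolding Z1_def Z2_def
    by (intro closedin_Int continuous_closedin_preimage_constant smooth2_continuous smooth2_scalars)+
  have prod: "j.E1 r s = 0 \<or> j.E2 r s = 0" if "(r, s) \<in> D" for r s
    using B4[OF that] j.B4_eq[of s r] j.D1_nz[of s r] j.N_nz[of s r] j.R_nz[of s r] that by auto
  have cover: "D \<subseteq> Z1 \<union> Z2"
  proof
    fix q assume q: "q \<in> D"
    obtain r s where rs: "q = (r, s)" by (cases q)
    then have s: "s \<in> {s. (r, s) \<in> D}" using q by simp
    show "q \<in> Z1 \<union> Z2"
    proof (cases "j.E2 r s = 0")
      case True then show ?thesis using q rs by (simp add: Z2_def)
    next
      case False
      \<comment> \<open>\<open>E2\<close> stays nonzero nearby on the slice, so \<open>E1\<close>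
        vanishes on a neighbourhood of s, and its derivative vanishes at s.\<close>
      have "isCont (j.E2 r) s" using j.E2_deriv[OF s] DERIV_isCont by blast
      then have "\<forall>\<^sub>F t in at s. j.E2 r t \<noteq> 0"
        using False unfolding isCont_def by (rule tendsto_imp_eventually_ne)
      moreover have "\<forall>\<^sub>F t in at s. t \<in> {s. (r, s) \<in> D}"
        using eventually_at_topological open_slices(1)[of r] s by blast
      ultimately have "\<forall>\<^sub>F t in at s. j.E1 r t = 0"
        by eventually_elim (use prod in auto)
      moreover have E1: "j.E1 r s = 0" using prod[of r s] False q rs by simp
      ultimately have "\<forall>\<^sub>F t in nhds s. j.E1 r t = 0"
        by (simp add: eventually_nhds_conv_at)
      then have "(j.E1 r has_real_derivative 0) (at s)"
        by (subst DERIV_cong_ev[OF refl _ refl]) auto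
      then have "j.E1' r s = 0" using j.E1_deriv[OF s] DERIV_unique by blast
      then show ?thesis using E1 q rs by (simp add: Z1_def)
    qed
  qed
  have "Z1 \<inter> Z2 = {}" using j.E_disjoint by (auto simp: Z1_def Z2_def)
  then have "Z1 = {} \<or> Z2 = {}"
    using D_props(2) cl cover unfolding connected_closedin by blast
  then show ?thesis using cover by (auto simp: Z1_def Z2_def)
qed

lemma zero_deriv:
  assumes f: "\<And>s. (r, s) \<in> D \<Longrightarrow> f s = 0" and d: "(f has_real_derivative d) (at s)" and rs: "(r, s) \<in> D"
  shows "d = (0::real)"
proof -
  have "(f has_real_derivative 0) (at s)"
    by (rule has_field_derivative_transform_within_open[of "\<lambda>_. 0", OF _ open_slices(1)[of r]]) (use f rs in auto)
  then show ?thesis using d DERIV_unique by blast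
qed

lemma A4_eq_0_of_E2_on_D: assumes "\<And>r s. (r, s) \<in> D \<Longrightarrow> j.E2 r s = 0" "(r, s) \<in> D" shows "j.A4 r s = 0"
  by (rule j.A4_eq_0_of_E2)
     (use assms zero_deriv[of r, OF assms(1) j.E2_deriv assms(2)] in auto)

lemma ABC_eq_0_of_E1:
  assumes E1: "\<And>r s. (r, s) \<in> D \<Longrightarrow> j.E1 r s = 0" and rs: "(r, s) \<in> D"
  shows "j.A4 r s = 0" "j.B4 r s = 0" "j.C4 r s = 0"
proof -
  have E1': "j.E1' r s = 0" if "(r, s) \<in> D" for r s
    using zero_deriv[of r, OF E1 j.E1_deriv that] that by simp
  show "j.A4 r s = 0"
    by (rule j.A4_eq_0_of_E1) (use E1 E1' zero_deriv[of r, OF E1' j.E1'_deriv rs] rs in auto)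
  show "j.B4 r s = 0" "j.C4 r s = 0" using E1 rs by (simp_all add: j.B4_eq j.C4_eq)
qed

lemma spherical_jet: 
  fixes x :: "real^'n::finite"
  shows "spherical_jet x {s. (norm x, s) \<in> D} (J 0 (norm x)) (J (Suc 0) (norm x)) (J 2 (norm x)) (J 3 (norm x)) (J 4 (norm x))
    (sph_metric \<phi>)"
  by unfold_locales (simp add: sph_metric_def J0)

end

text \<open>This is where dimension at least three enters.\<close>

lemma exists_unit_orthogonal_pair:
  fixes a b :: "real^'n::finite"
  assumes "CARD('n) \<ge> 3"
  obtains c where "norm c = 1" "a \<bullet> c = 0" "b \<bullet> c = 0"
proof -
  have "dim {a, b} \<le> card {a, b}" by (rule dim_le_card) (auto intro: span_base)
  also have "\<dots> \<le> 2" by (simp add: card_insert_if)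
  finally have "dim {a, b} < DIM(real^'n)" using assms by simp
  then obtain d where d: "d \<noteq> 0" "\<And>v. v \<in> span {a, b} \<Longrightarrow> orthogonal d v"
    using orthogonal_to_subspace_exists by blast
  have "orthogonal d a" "orthogonal d b" using d(2) by (auto intro: span_base)
  then have "a \<bullet> d = 0" "b \<bullet> d = 0" by (auto simp: orthogonal_def inner_commute)
  then show ?thesis using d(1) by (intro that[of "d /\<^sub>R norm d"]) auto
qed

section \<open>From the scalar equations to the two conditions and back\<close>

context spherical_data
begin

lemma sph_domain_Y:
  fixes x :: "real^'n::finite"
  shows "(x, y) \<in> sph_domain D \<longleftrightarrow>
    y \<in> spherical_jet.Y x {s. (norm x, s) \<in> D}"
proof -
  interpret f: spherical_jet x "{s. (norm x, s) \<in> D}" "J 0 (norm x)" "J (Suc 0) (norm x)" "J 2 (norm x)"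
    "J 3 (norm x)" "J 4 (norm x)" "sph_metric \<phi>" by (rule spherical_jet)
  show ?thesis by (simp add: sph_domain_def f.Y_def f.s_def)
qed

lemma T_condition_of_E1:
  assumes "\<And>r s. (r, s) \<in> D \<Longrightarrow> j.E1 r s = 0"
  shows "T_condition (sph_domain D) (sph_metric \<phi> :: real^'n::finite \<Rightarrow> _)"
  unfolding T_condition_def
proof safe
  fix x y :: "real^'n" and a b c d
  interpret f: spherical_jet x "{s. (norm x, s) \<in> D}" "J 0 (norm x)" "J (Suc 0) (norm x)" "J 2 (norm x)"
    "J 3 (norm x)" "J 4 (norm x)" "sph_metric \<phi>" by (rule spherical_jet)
  assume "(x, y) \<in> sph_domain D"
  then have y: "y \<in> f.Y" by (simp add: sph_domain_Y)
  then have "(norm x, f.s y) \<in> D" by (simp add: f.Y_def)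
  from ABC_eq_0_of_E1[OF assms this] show "T_tensor (sph_metric \<phi>) x y a b c d = 0"
    by (intro f.T_tensor_eq_0 y)
qed

lemma smooth_on_inner_self:
  fixes B :: "(real^'n::finite) set"
  assumes "open B" shows "smooth_on B (\<lambda>x. x \<bullet> x)"
  unfolding smooth_on_def
proof
  fix k
  have "Ck_on (Suc k) B (\<lambda>x. x \<bullet> x)"
  proof (rule Ck_on_SucI[OF assms])
    show "((\<lambda>x. x \<bullet> x) has_derivative (\<lambda>v. x \<bullet> v + v \<bullet> x)) (at x)" for x :: "real^'n"
      by (rule has_derivative_inner) (rule has_derivative_ident)+
    show "Ck_on k B (\<lambda>x. x \<bullet> v + v \<bullet> x)" for v
      by (intro Ck_on_linear assms bounded_linear_add bounded_linear_inner_left bounded_linear_inner_right)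
  qed
  then show "Ck_on k B (\<lambda>x. x \<bullet> x)" by (rule Ck_on_SucD)
qed

lemma partial_inner_self: "partial k (\<lambda>x. x \<bullet> x) (x :: real^'n::finite) = 2 * x $ k"
proof -
  have "((\<lambda>x. x \<bullet> x) has_derivative (\<lambda>v. x \<bullet> v + v \<bullet> x)) (at x)"
    by (rule has_derivative_inner) (rule has_derivative_ident)+
  then have "has_partial (\<lambda>x. x \<bullet> x) k (2 * x $ k) x"
    unfolding has_partial_def by (intro exI[of _ "\<lambda>v. x \<bullet> v + v \<bullet> x"]) (simp add: inner_axis inner_axis')
  then show ?thesis by (rule partial_eqI)
qed

lemma open_base: "open (base_domain D :: (real^'n::finite) set)"
proof -
  have "(base_domain D :: (real^'n) set) = norm -` (fst ` D)" by (force simp: base_domain_def image_iff)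
  moreover have "open (norm -` (fst ` D) :: (real^'n) set)"
    by (rule open_vimage[OF open_image_fst[OF D_props(1)]]) (intro continuous_intros)
  ultimately show ?thesis by simp
qed

text \<open>One witness for both converse directions: sigma = |x|^2, whose gradient 2 x is nonzero
  on the base domain because r > 0 on D.\<close>

lemma sigmaT_square:
  assumes "\<And>(x :: real^'n::finite) y i j k. (x, y) \<in> sph_domain D \<Longrightarrow>
    (\<Sum>h\<in>UNIV. 2 * x $ h * T_tensor_up (sph_metric \<phi>) x y h i j k) = 0"
  shows "sigmaT_condition (base_domain D) (sph_domain D) (sph_metric \<phi> :: real^'n::finite \<Rightarrow> _)"
  unfolding sigmaT_condition_def
proof (rule exI[of _ "\<lambda>x. x \<bullet> x"], intro conjI ballI)
  show "smooth_on (base_domain D) (\<lambda>x :: real^'n. x \<bullet> x)" by (rule smooth_on_inner_self[OF open_base])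
  show "\<exists>h. partial h (\<lambda>x. x \<bullet> x) x \<noteq> 0" if x: "x \<in> base_domain D" for x :: "real^'n"
  proof -
    obtain s where "(norm x, s) \<in> D" using x by (auto simp: base_domain_def)
    then have "norm x > 0" by (rule D_props(4))
    then have "x \<noteq> 0" by auto
    then show ?thesis by (auto simp: partial_inner_self vec_eq_iff)
  qed
qed (use assms in \<open>auto simp: partial_inner_self\<close>)

lemma sigmaT_of_E2:
  assumes E2: "\<And>r s. (r, s) \<in> D \<Longrightarrow> j.E2 r s = 0"
  shows "sigmaT_condition (base_domain D) (sph_domain D) (sph_metric \<phi> :: real^'n::finite \<Rightarrow> _)"
proof (rule sigmaT_square)
  fix x y :: "real^'n" and i j k
  interpret f: spherical_jet x "{s. (norm x, s) \<in> D}" "J 0 (norm x)" "J (Suc 0) (norm x)" "J 2 (norm x)"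
    "J 3 (norm x)" "J 4 (norm x)" "sph_metric \<phi>" by (rule spherical_jet)
  assume "(x, y) \<in> sph_domain D"
  then have y: "y \<in> f.Y" by (simp add: sph_domain_Y)
  then have rs: "(norm x, f.s y) \<in> D" by (simp add: f.Y_def)
  show "(\<Sum>h\<in>UNIV. 2 * x $ h * T_tensor_up (sph_metric \<phi>) x y h i j k) = 0"
  proof (rule f.contracted_T_eq_0[OF y])
    show "j.A4 (norm x) (f.s y) = 0" using A4_eq_0_of_E2_on_D E2 rs by blast
    show "j.B4 (norm x) (f.s y) = 0" using E2[OF rs] rs by (simp add: j.B4_eq)
  qed
qed

lemma sigmaT_of_T_condition:
  assumes "T_condition (sph_domain D) (sph_metric \<phi> :: real^'n::finite \<Rightarrow> _)"
  shows "sigmaT_condition (base_domain D) (sph_domain D) (sph_metric \<phi> :: real^'n::finite \<Rightarrow> _)"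
  by (rule sigmaT_square) (use assms in \<open>auto simp: T_tensor_up_def T_condition_def\<close>)

lemma B4_of_sigmaT:
  assumes n: "CARD('n::finite) \<ge> 3"
    and \<sigma>T: "sigmaT_condition (base_domain D) (sph_domain D) (sph_metric \<phi> :: real^'n \<Rightarrow> _)"
    and rs: "(r, s) \<in> D"
  shows "j.B4 r s = 0"
proof -
  obtain \<sigma> where nonzero: "\<And>x :: real^'n. x \<in> base_domain D \<Longrightarrow> \<exists>h. partial h \<sigma> x \<noteq> 0"
    and T: "\<And>x y :: real^'n. \<And>i j k. (x, y) \<in> sph_domain D \<Longrightarrow>
      (\<Sum>h\<in>UNIV. partial h \<sigma> x * T_tensor_up (sph_metric \<phi>) x y h i j k) = 0"
    using \<sigma>T unfolding sigmaT_condition_def by fast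
  have r: "r > 0" "\<bar>s\<bar> < r" using D_props rs by auto
  \<comment> \<open>\<open>undefined\<close> just selects some coordinate axis; any x of norm r
    would serve.\<close>
  define x :: "real^'n" where "x = r *\<^sub>R axis undefined 1"
  have x: "norm x = r" using r by (simp add: x_def)
  have xx: "x \<bullet> x = r\<^sup>2" using x by (simp add: dot_square_norm)
  define v :: "real^'n" where "v = (\<chi> h. partial h \<sigma> x)"
  have "x \<in> base_domain D" using x rs by (auto simp: base_domain_def)
  then have v0: "v \<noteq> 0" using nonzero by (auto simp: v_def vec_eq_iff)
  define q where "q = x \<bullet> v / r\<^sup>2"
  define v' where "v' = v - q *\<^sub>R x"
  have xv': "x \<bullet> v' = 0" using r by (simp add: v'_def q_def inner_diff_right xx)
  \<comment> \<open>y will be taken in the plane of x and c, hence orthogonal to the transverse part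
    \<open>v'\<close> of the gradient.\<close>
  obtain c where c: "norm c = 1" "x \<bullet> c = 0" "v' \<bullet> c = 0"
    using exists_unit_orthogonal_pair[OF n] .
  \<comment> \<open>z is the transverse part of v. If that is zero, any vector orthogonal to x and c
    will do, and q is nonzero because v is.\<close>
  obtain z t where z: "z \<noteq> 0" "x \<bullet> z = 0" "c \<bullet> z = 0" "v = q *\<^sub>R x + t *\<^sub>R z" "q \<noteq> 0 \<and> t = 0 \<or> t = 1"
  proof (cases "v' = 0")
    case True
    obtain z where "norm z = 1" "x \<bullet> z = 0" "c \<bullet> z = 0" using exists_unit_orthogonal_pair[OF n] .
    then show ?thesis using True v0 by (intro that[of z 0]) (auto simp: v'_def)
  next
    case False
    then show ?thesis using xv' c(3) by (intro that[of v' 1]) (auto simp: v'_def inner_commute)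
  qed
  \<comment> \<open>The unit vector in the plane of x and c with inner product s with x.\<close>
  define y where "y = (s / r\<^sup>2) *\<^sub>R x + sqrt (1 - (s / r)\<^sup>2) *\<^sub>R c"
  have "(s / r)\<^sup>2 \<le> 1" using r by (simp add: abs_square_le_1)
  moreover have "y \<bullet> y = (s / r\<^sup>2)\<^sup>2 * r\<^sup>2 + (sqrt (1 - (s / r)\<^sup>2))\<^sup>2"
    using c unfolding y_def inner_add_left inner_add_right inner_scaleR_left inner_scaleR_right xx
    by (simp add: inner_commute[of c x] dot_square_norm power2_eq_square)
  ultimately have "y \<bullet> y = 1" using r by (simp add: power_divide field_simps power2_eq_square)
  then have y1: "norm y = 1" by (simp add: norm_eq_1)
  have xy: "x \<bullet> y = s" using c r by (simp add: y_def inner_add_right xx)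
  interpret f: spherical_jet x "{s. (norm x, s) \<in> D}" "J 0 (norm x)" "J (Suc 0) (norm x)" "J 2 (norm x)"
    "J 3 (norm x)" "J 4 (norm x)" "sph_metric \<phi>" by (rule spherical_jet)
  have s: "f.s y = s" by (simp add: f.s_def y1 xy)
  have Y: "y \<in> f.Y" using y1 rs s x by (auto simp: f.Y_def)
  have "y \<bullet> z = 0" using z by (simp add: y_def inner_add_left)
  then have "j.B4 (norm x) (f.s y) = 0"
    using f.B4_eq_0[OF Y, of v z q t] T[of x y] Y z by (simp add: sph_domain_Y v_def)
  then show ?thesis by (simp add: s x)
qed

section \<open>The explicit family\<close>

definition C1 :: "real \<Rightarrow> real \<Rightarrow> real" where "C1 r s = (s * j.psi r s + j.R r s * j.psi1 r s) / r\<^sup>2"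
text \<open>\<open>C1\<close> and \<open>C2\<close> come from Cramer's rule for \<open>psi\<close>
  and \<open>psi1\<close> in the basis s, sqrt (r^2 - s^2), whose Wronskian - r^2 / sqrt R accounts
  for the division by r^2.\<close>

definition C2 :: "real \<Rightarrow> real \<Rightarrow> real" where "C2 r s = j.e r s * sqrt (j.R r s) / r\<^sup>2"

text \<open>The s-derivatives are E2 / r^2 and - s E2 / (r^2 sqrt R). They vanish, and the slices
  are intervals.\<close>

lemma C12_const:
  assumes E2: "\<And>r s. (r, s) \<in> D \<Longrightarrow> j.E2 r s = 0" and rs: "(r, s) \<in> D" "(r, s') \<in> D"
  shows "C1 r s = C1 r s'" "C2 r s = C2 r s'"
proof -
  let ?I = "{s. (r, s) \<in> D}"
  have conv: "convex ?I" using D_props(6) is_interval_convex by blast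
  have d1: "(C1 r has_real_derivative 0) (at t)" if t: "t \<in> ?I" for t
  proof -
    have "((\<lambda>t. t * j.psi r t + j.R r t * j.psi1 r t) has_real_derivative j.E2 r t) (at t)"
      by (rule derivative_eq_intros j.psi_deriv[OF t] j.psi1_deriv[OF t] j.R_deriv[OF t] refl)+
         (simp add: j.E2_def j.e_def)
    then show ?thesis
      using DERIV_cdivide[of _ "j.E2 r t" t UNIV "r\<^sup>2"] E2 t unfolding C1_def[abs_def] by fastforce
  qed
  have d2: "(C2 r has_real_derivative 0) (at t)" if t: "t \<in> ?I" for t
  proof -
    have R: "j.R r t > 0" using j.R_pos[OF t] .
    then have R': "j.R r t = sqrt (j.R r t) * sqrt (j.R r t)" by simp
    have "((\<lambda>t. j.e r t * sqrt (j.R r t)) has_real_derivative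
       j.e r t * (inverse (sqrt (j.R r t)) / 2 * (- 2 * t)) + - t * j.psi2 r t * sqrt (j.R r t)) (at t)"
      by (rule DERIV_mult'[OF j.e_deriv[OF t] DERIV_chain2[OF DERIV_real_sqrt[OF R] j.R_deriv[OF t]]])
    moreover have "j.e r t * (inverse (sqrt (j.R r t)) / 2 * (- 2 * t)) + - t * j.psi2 r t * sqrt (j.R r t)
        = - t * j.E2 r t / sqrt (j.R r t)"
      using R by (simp add: j.E2_def field_simps)
    ultimately have "((\<lambda>t. j.e r t * sqrt (j.R r t)) has_real_derivative 0) (at t)"
      using E2 t by simp
    then show ?thesis
      using DERIV_cdivide[of _ 0 t UNIV "r\<^sup>2"] unfolding C2_def[abs_def] by fastforce
  qed
  show "C1 r s = C1 r s'" "C2 r s = C2 r s'"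
    using has_field_derivative_zero_constant[OF conv DERIV_subset[OF d1 subset_UNIV]]
      has_field_derivative_zero_constant[OF conv DERIV_subset[OF d2 subset_UNIV]] rs by fastforce+
qed

lemma psi_C12: assumes "(r, s) \<in> D" shows "C1 r s * s + C2 r s * sqrt (r\<^sup>2 - s\<^sup>2) = j.psi r s"
proof -
  have R: "j.R r s = r\<^sup>2 - s\<^sup>2" by (rule j.R_def)
  have *: "a / d * b + k * q / d * q = (a * b + k * (q * q)) / d" for a b d k q :: real
    by (simp add: add_divide_distrib mult.assoc)
  have sq: "sqrt (j.R r s) * sqrt (j.R r s) = j.R r s" using j.R_pos[of s r] assms by simp
  have "C1 r s * s + C2 r s * sqrt (j.R r s)
      = ((s * j.psi r s + j.R r s * j.psi1 r s) * s + j.e r s * (sqrt (j.R r s) * sqrt (j.R r s))) / r\<^sup>2"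
    unfolding C1_def C2_def by (rule *)
  also have "\<dots> = ((s * j.psi r s + j.R r s * j.psi1 r s) * s + (j.psi r s - s * j.psi1 r s) * j.R r s) / r\<^sup>2"
    unfolding sq j.e_def ..
  also have "\<dots> = (s\<^sup>2 + j.R r s) * j.psi r s / r\<^sup>2" by (simp add: algebra_simps power2_eq_square)
  also have "\<dots> = j.psi r s" using D_props(4)[OF assms] by (simp add: R)
  finally show ?thesis by (simp add: R)
qed

lemma smooth2_C12: "smooth2 C1" "smooth2 C2"
proof -
  have "r\<^sup>2 \<noteq> 0" if "(r, s) \<in> D" for r s using D_props(4)[OF that] by simp
  then show "smooth2 C1" "smooth2 C2"
    unfolding C1_def[abs_def] C2_def[abs_def]
    by (intro smooth2_intros smooth2_scalars; use j.R_pos in auto)+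
qed

text \<open>Near a given r the function c can be read off along one line of constant s, which stays
  in D for nearby r because D is open.\<close>

lemma smooth_on_fst_image:
  assumes "smooth2 f" and "\<And>r s. (r, s) \<in> D \<Longrightarrow> c r = f r s"
  shows "smooth_on (fst ` D) c"
proof (rule smooth_on_local)
  fix r assume "r \<in> fst ` D"
  then obtain s where rs: "(r, s) \<in> D" by auto
  let ?U = "{r. (r, s) \<in> D}"
  have "smooth_on ?U (\<lambda>r. f r s)"
    using smooth_on_slice[OF D_props(1) assms(1)[unfolded smooth2_def], of s] by simp
  then have "smooth_on ?U c"
    by (rule smooth_on_cong[OF open_slices(2)]) (use assms(2) in auto)
  then show "\<exists>U. open U \<and> r \<in> U \<and> smooth_on U c" using open_slices(2) rs by blast
qed

lemma explicit_of_E2: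
  assumes E2: "\<And>r s. (r, s) \<in> D \<Longrightarrow> j.E2 r s = 0"
  shows "\<exists>A c1 c2 :: real \<Rightarrow> real. \<exists>P :: real \<Rightarrow> real \<Rightarrow> real.
       smooth_on (fst ` D) A \<and> smooth_on (fst ` D) c1 \<and> smooth_on (fst ` D) c2 \<and>
       (\<forall>r\<in>fst ` D. A r > 0) \<and>
       (\<forall>(r, s)\<in>D.
          1 + c1 r * s\<^sup>2 + c2 r * s * sqrt (r\<^sup>2 - s\<^sup>2) \<noteq> 0 \<and>
          (P r has_real_derivative
             (c1 r * s + c2 r * sqrt (r\<^sup>2 - s\<^sup>2)) /
             (1 + c1 r * s\<^sup>2 + c2 r * s * sqrt (r\<^sup>2 - s\<^sup>2))) (at s) \<and>
          \<phi> r s = A r * exp (P r s))"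
proof -
  define c1 where "c1 r = C1 r (SOME s. (r, s) \<in> D)" for r
  define c2 where "c2 r = C2 r (SOME s. (r, s) \<in> D)" for r
  have c: "c1 r = C1 r s" "c2 r = C2 r s" if "(r, s) \<in> D" for r s
    using C12_const[OF E2 _ that] someI[of "\<lambda>s. (r, s) \<in> D", OF that] by (auto simp: c1_def c2_def)
  have psi: "c1 r * s + c2 r * sqrt (r\<^sup>2 - s\<^sup>2) = j.psi r s" if "(r, s) \<in> D" for r s
    using psi_C12[OF that] c[OF that] by simp
  have w: "1 + c1 r * s\<^sup>2 + c2 r * s * sqrt (r\<^sup>2 - s\<^sup>2) = j.w r s" if "(r, s) \<in> D" for r s
    unfolding j.w_def psi[OF that, symmetric] by (simp add: algebra_simps power2_eq_square)
  have P: "((\<lambda>s. ln (\<phi> r s)) has_real_derivative j.psi r s / j.w r s) (at s)" if "(r, s) \<in> D" for r s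
  proof -
    have s: "s \<in> {s. (r, s) \<in> D}" using that by simp
    have d: "(\<phi> r has_real_derivative J (Suc 0) r s) (at s)"
      using j.deriv(1)[OF s] by (simp add: J0)
    have "J (Suc 0) r s / J 0 r s = j.psi r s / j.w r s"
      using j.D1_nz[OF s] j.w_nz[OF s] by (simp add: j.jet_eq(1,2)[OF s])
    then show ?thesis
      using DERIV_chain2[OF DERIV_ln_divide[OF D_props(7)[OF that]] d] by (simp add: J0)
  qed
  have sc: "smooth_on (fst ` D) c1" "smooth_on (fst ` D) c2"
    using smooth_on_fst_image[OF smooth2_C12(1) c(1)] smooth_on_fst_image[OF smooth2_C12(2) c(2)] by blast+
  have s1: "smooth_on (fst ` D) (\<lambda>_. 1)"
    by (rule smooth_on_const[OF open_image_fst[OF D_props(1)]])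
  show ?thesis
    \<comment> \<open>A primitive in s is free up to a function of r, so it can absorb A entirely: A
      = 1 and P = ln phi.\<close>
    by (rule exI[of _ "\<lambda>_. 1"], rule exI[of _ c1], rule exI[of _ c2], rule exI[of _ "\<lambda>r s. ln (\<phi> r s)"])
       (use sc s1 P D_props(7) j.w_nz in \<open>auto simp: w psi\<close>)
qed

lemma E2_of_explicit:
  assumes X: "\<And>r s. (r, s) \<in> D \<Longrightarrow>
          1 + c1 r * s\<^sup>2 + c2 r * s * sqrt (r\<^sup>2 - s\<^sup>2) \<noteq> 0 \<and>
          (P r has_real_derivative
             (c1 r * s + c2 r * sqrt (r\<^sup>2 - s\<^sup>2)) /
             (1 + c1 r * s\<^sup>2 + c2 r * s * sqrt (r\<^sup>2 - s\<^sup>2))) (at s) \<and>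
          \<phi> r s = A r * exp (P r s)"
    and rs: "(r, s) \<in> D"
  shows "j.E2 r s = 0"
proof -
  let ?I = "{s. (r, s) \<in> D}" and ?rt = "\<lambda>s. sqrt (r\<^sup>2 - s\<^sup>2)"
  have rt: "r\<^sup>2 - t\<^sup>2 > 0" if "t \<in> ?I" for t
    using j.R_pos[OF that] by (simp add: j.R_def)
  have drt: "(?rt has_real_derivative - t / ?rt t) (at t)" if "t \<in> ?I" for t
    using rt[OF that] by (auto intro!: derivative_eq_intros simp: field_simps)
  have psi: "j.psi r t = c1 r * t + c2 r * ?rt t" if t: "t \<in> ?I" for t
  proof -
    define Q where "Q = c1 r * t + c2 r * ?rt t"
    have W: "1 + c1 r * t\<^sup>2 + c2 r * t * ?rt t = 1 + t * Q"
      by (simp add: Q_def algebra_simps power2_eq_square)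
    have P: "(P r has_real_derivative Q / (1 + t * Q)) (at t)" and Q: "1 + t * Q \<noteq> 0"
      using X[of r t] t unfolding W Q_def[symmetric] by auto
    have "((\<lambda>t. A r * exp (P r t)) has_real_derivative A r * (exp (P r t) * (Q / (1 + t * Q)))) (at t)"
      by (intro DERIV_cmult DERIV_chain2[OF DERIV_exp P])
    then have "(\<phi> r has_real_derivative A r * (exp (P r t) * (Q / (1 + t * Q)))) (at t)"
      by (rule has_field_derivative_transform_within_open[OF _ open_slices(1)[of r] t]) (use X in auto)
    then have 1: "J (Suc 0) r t = J 0 r t * (Q / (1 + t * Q))"
      using j.deriv(1)[OF t] DERIV_unique X[of r t] t by (fastforce simp: J0)
    \<comment> \<open>Inverts the logarithmic derivative: phi_s = phi Q / (1 + t Q) divided by this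
      value of \<open>D1\<close> is Q.\<close>
    have "j.D1 r t = J 0 r t / (1 + t * Q)"
      unfolding j.D1_def 1 using Q by (simp add: field_simps)
    then show ?thesis
      unfolding j.psi_def 1 using Q j.f0_pos[OF t] by (simp add: Q_def)
  qed
  have psi1: "j.psi1 r t = c1 r - c2 r * (t / ?rt t)" if t: "t \<in> ?I" for t
  proof -
    have "((\<lambda>t. c1 r * t + c2 r * ?rt t) has_real_derivative c1 r * 1 + c2 r * (- t / ?rt t)) (at t)"
      by (intro DERIV_add DERIV_cmult DERIV_ident drt t)
    then have "(j.psi r has_real_derivative c1 r * 1 + c2 r * (- t / ?rt t)) (at t)"
      by (rule has_field_derivative_transform_within_open[OF _ open_slices(1)[of r] t]) (simp add: psi)
    then show ?thesis using j.psi_deriv[OF t] DERIV_unique by fastforce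
  qed
  have s: "s \<in> ?I" using rs by simp
  have rt0: "?rt s \<noteq> 0" using rt[OF s] by simp
  have "((\<lambda>t. c1 r - c2 r * (t / ?rt t)) has_real_derivative
      0 - c2 r * ((1 * ?rt s - s * (- s / ?rt s)) / (?rt s * ?rt s))) (at s)"
    by (intro DERIV_diff DERIV_cmult DERIV_const DERIV_divide DERIV_ident drt s rt0)
  then have "(j.psi1 r has_real_derivative 0 - c2 r * ((1 * ?rt s - s * (- s / ?rt s)) / (?rt s * ?rt s))) (at s)"
    by (rule has_field_derivative_transform_within_open[OF _ open_slices(1)[of r] s]) (simp add: psi1)
  then have psi2: "j.psi2 r s = 0 - c2 r * ((1 * ?rt s - s * (- s / ?rt s)) / (?rt s * ?rt s))"
    using j.psi1_deriv[OF s] DERIV_unique by blast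
  define h where "h = ?rt s"
  have R: "j.R r s = h\<^sup>2" using rt[OF s] by (simp add: j.R_def h_def)
  show ?thesis
    unfolding j.E2_def j.e_def psi2 psi1[OF s] psi[OF s] R h_def[symmetric]
    using rt0 unfolding h_def[symmetric] by (simp add: field_simps power2_eq_square)
qed

end

theorem theorem3p4:
  fixes D :: "(real \<times> real) set" and \<phi> :: "real \<Rightarrow> real \<Rightarrow> real"
    and F :: "real^'n::finite \<Rightarrow> real^'n \<Rightarrow> real"
  assumes n: "CARD('n) \<ge> 3"
    and \<phi>: "sph_finsler D \<phi>"
    and F: "F = sph_metric \<phi>"
  shows "sigmaT_condition (base_domain D) (sph_domain D) F \<longleftrightarrow>
    T_condition (sph_domain D) F \<or>
    (\<exists>A c1 c2 :: real \<Rightarrow> real. \<exists>P :: real \<Rightarrow> real \<Rightarrow> real.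
       smooth_on (fst ` D) A \<and> smooth_on (fst ` D) c1 \<and> smooth_on (fst ` D) c2 \<and>
       (\<forall>r\<in>fst ` D. A r > 0) \<and>
       (\<forall>(r, s)\<in>D.
          1 + c1 r * s\<^sup>2 + c2 r * s * sqrt (r\<^sup>2 - s\<^sup>2) \<noteq> 0 \<and>
          (P r has_real_derivative
             (c1 r * s + c2 r * sqrt (r\<^sup>2 - s\<^sup>2)) /
             (1 + c1 r * s\<^sup>2 + c2 r * s * sqrt (r\<^sup>2 - s\<^sup>2))) (at s) \<and>
          \<phi> r s = A r * exp (P r s)))"
    (is "?\<sigma> \<longleftrightarrow> ?T \<or> ?X")
proof
  interpret spherical_data D \<phi> using \<phi> by unfold_locales
  show "?T \<or> ?X" if ?\<sigma>
  proof -
    have "\<And>r s. (r, s) \<in> D \<Longrightarrow> j.B4 r s = 0" using B4_of_sigmaT[OF n] that F by blast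
    from E1_or_E2[OF this] show ?thesis
    proof
      assume "\<forall>(r, s)\<in>D. j.E1 r s = 0"
      then show ?thesis using T_condition_of_E1 F by blast
    next
      assume "\<forall>(r, s)\<in>D. j.E2 r s = 0"
      then have "?X" by (intro explicit_of_E2) blast
      then show ?thesis by (rule disjI2)
    qed
  qed
  show ?\<sigma> if "?T \<or> ?X"
    using that
  proof
    assume ?T then show ?thesis using sigmaT_of_T_condition F by blast
  next
    assume ?X
    then obtain A c1 c2 :: "real \<Rightarrow> real" and P where "\<forall>(r, s)\<in>D.
          1 + c1 r * s\<^sup>2 + c2 r * s * sqrt (r\<^sup>2 - s\<^sup>2) \<noteq> 0 \<and>
          (P r has_real_derivative
             (c1 r * s + c2 r * sqrt (r\<^sup>2 - s\<^sup>2)) /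
             (1 + c1 r * s\<^sup>2 + c2 r * s * sqrt (r\<^sup>2 - s\<^sup>2))) (at s) \<and>
          \<phi> r s = A r * exp (P r s)" by blast
    then have "\<And>r s. (r, s) \<in> D \<Longrightarrow> j.E2 r s = 0"
      by (intro E2_of_explicit[of c1 c2 P A]) auto
    then show ?thesis using sigmaT_of_E2 F by blast
  qed
qed

end
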